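(* Let $\Omega\subset\mathbb R^N$ be a bounded domain which is convex or of class $C^2$, $\nu,\kappa>0$, $(u_0,v_0)\in\mathcal H=H^1_0(\Omega)\times L^2(\Omega)$, and let $\mathcal F:L^2(\Omega)\to L^2(\Omega)$ be continuous and map bounded sets to bounded sets. If $\mathcal F$ is locally Lipschitz, then the maximal solution of $$u_{tt}=-\nu u_t+\kappa\nabla^2u+\mathcal F(u),\quad u=0\text{ on }\partial\Omega,\quad(u,u_t)|_{t=0}=(u_0,v_0)$$ is unique.
   Context: Weak solution on $J=[0,T_1]$: a function $u$ with $(u,u_t)\in C(J;\mathcal H)$, $u_{tt}\in C(J;H^{-1}(\Omega))$, $(u(0),u_t(0))=(u_0,v_0)$, and for all $\phi\in C(J;H^1_0(\Omega))$ and $0<t\le T_1$: $(u_{tt},\phi)_{L^2}=-\nu(u_t,\phi)_{L^2}-\kappa(\nabla u,\nabla\phi)_{L^2}+(\mathcal F(u),\phi)_{L^2}$ (the left side being the $H^{-1}$–$H^1_0$ pairing). A function on $[0,\tau)$, $0<\tau\le\infty$, whose restriction to every compact $[0,T_1]\subset[0,\tau)$ is a weak solution is called a maximal solution if it has no proper extension which is a weak solution. *)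

theory Defs
  imports "HOL-Analysis.Analysis"
begin

text \<open>
  Conventions. Elements of the Lebesgue and Sobolev spaces over \<open>\<Omega>\<close> are represented by functions
  on the ambient space; only their values almost everywhere on \<open>\<Omega>\<close> (with respect to
  \<open>lebesgue_on \<Omega>\<close>) matter. Equality of elements is \<open>ae_eq \<Omega>\<close>, and all topological
  notions are expressed through the (semi)norms. An operator on \<open>L\<^sup>2(\<Omega>)\<close> is given on
  representatives; if it is continuous for the seminorm, it automatically respects \<open>ae_eq \<Omega>\<close>.
\<close>

primrec Ck :: "nat \<Rightarrow> ('a::euclidean_space \<Rightarrow> real) \<Rightarrow> bool" where
  "Ck 0 f \<longleftrightarrow> continuous_on UNIV f"
| "Ck (Suc k) f \<longleftrightarrow>
     (\<exists>g. (\<forall>x. (f has_derivative (\<lambda>h. g x \<bullet> h)) (at x)) \<and> (\<forall>b\<in>Basis. Ck k (\<lambda>x. g x \<bullet> b)))"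

definition test_functions :: "'a::euclidean_space set \<Rightarrow> ('a \<Rightarrow> real) set" where
  "test_functions \<Omega> =
     {\<phi>. (\<forall>k. Ck k \<phi>) \<and> compact (closure {x. \<phi> x \<noteq> 0}) \<and> closure {x. \<phi> x \<noteq> 0} \<subseteq> \<Omega>}"

definition bounded_domain :: "'a::euclidean_space set \<Rightarrow> bool" where
  "bounded_domain \<Omega> \<longleftrightarrow> open \<Omega> \<and> connected \<Omega> \<and> \<Omega> \<noteq> {} \<and> bounded \<Omega>"

text \<open>
  Near each boundary point, \<open>\<Omega>\<close> is the part above the graph of a \<open>C\<^sup>k\<close> function \<open>\<gamma>\<close>, where the
  unit vector \<open>e\<close> is the vertical direction. Only the restriction of \<open>\<gamma>\<close> to the hyperplane
  orthogonal to \<open>e\<close> matters; every \<open>C\<^sup>k\<close> function on that hyperplane is such a restriction.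
\<close>

definition domain_of_class_Ck :: "nat \<Rightarrow> 'a::euclidean_space set \<Rightarrow> bool" where
  "domain_of_class_Ck k \<Omega> \<longleftrightarrow>
     (\<forall>p\<in>frontier \<Omega>. \<exists>r>0. \<exists>e \<gamma>. norm e = 1 \<and> Ck k \<gamma> \<and>
        \<Omega> \<inter> ball p r = {x \<in> ball p r. \<gamma> (x - (x \<bullet> e) *\<^sub>R e) < x \<bullet> e})"

definition ae_eq :: "'a::euclidean_space set \<Rightarrow> ('a \<Rightarrow> 'b) \<Rightarrow> ('a \<Rightarrow> 'b) \<Rightarrow> bool" where
  "ae_eq \<Omega> f g \<longleftrightarrow> (AE x in lebesgue_on \<Omega>. f x = g x)"

definition L2 :: "'a::euclidean_space set \<Rightarrow> ('a \<Rightarrow> 'b::euclidean_space) set" where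
  "L2 \<Omega> = {f. f \<in> borel_measurable (lebesgue_on \<Omega>) \<and>
               integrable (lebesgue_on \<Omega>) (\<lambda>x. (norm (f x))\<^sup>2)}"

definition L2_inner ::
  "'a::euclidean_space set \<Rightarrow> ('a \<Rightarrow> 'b::euclidean_space) \<Rightarrow> ('a \<Rightarrow> 'b) \<Rightarrow> real" where
  "L2_inner \<Omega> f g = (LINT x|lebesgue_on \<Omega>. f x \<bullet> g x)"

definition L2_norm :: "'a::euclidean_space set \<Rightarrow> ('a \<Rightarrow> 'b::euclidean_space) \<Rightarrow> real" where
  "L2_norm \<Omega> f = sqrt (L2_inner \<Omega> f f)"

definition has_weak_grad ::
  "'a::euclidean_space set \<Rightarrow> ('a \<Rightarrow> real) \<Rightarrow> ('a \<Rightarrow> 'a) \<Rightarrow> bool" where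
  "has_weak_grad \<Omega> f g \<longleftrightarrow> f \<in> L2 \<Omega> \<and> g \<in> L2 \<Omega> \<and>
     (\<forall>\<phi>\<in>test_functions \<Omega>. \<forall>b\<in>Basis.
        (LINT x|lebesgue_on \<Omega>. f x * frechet_derivative \<phi> (at x) b) =
        - (LINT x|lebesgue_on \<Omega>. (g x \<bullet> b) * \<phi> x))"

definition weak_grad :: "'a::euclidean_space set \<Rightarrow> ('a \<Rightarrow> real) \<Rightarrow> 'a \<Rightarrow> 'a" where
  "weak_grad \<Omega> f = (SOME g. has_weak_grad \<Omega> f g)"

definition H1 :: "'a::euclidean_space set \<Rightarrow> ('a \<Rightarrow> real) set" where
  "H1 \<Omega> = {f. \<exists>g. has_weak_grad \<Omega> f g}"

definition H1_norm :: "'a::euclidean_space set \<Rightarrow> ('a \<Rightarrow> real) \<Rightarrow> real" where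
  "H1_norm \<Omega> f = sqrt ((L2_norm \<Omega> f)\<^sup>2 + (L2_norm \<Omega> (weak_grad \<Omega> f))\<^sup>2)"

definition H10 :: "'a::euclidean_space set \<Rightarrow> ('a \<Rightarrow> real) set" where
  "H10 \<Omega> = {f \<in> H1 \<Omega>. \<forall>\<epsilon>>0. \<exists>\<phi>\<in>test_functions \<Omega>. H1_norm \<Omega> (\<lambda>x. f x - \<phi> x) < \<epsilon>}"

text \<open>
  \<open>H\<^sup>-\<^sup>1(\<Omega>)\<close> is the dual of \<open>H\<^sup>1\<^sub>0(\<Omega>)\<close>; its pairing with \<open>H\<^sup>1\<^sub>0(\<Omega>)\<close> is function application.
  Only the values of a functional on \<open>H10 \<Omega>\<close> matter.
\<close>

definition Hm1 :: "'a::euclidean_space set \<Rightarrow> (('a \<Rightarrow> real) \<Rightarrow> real) set" where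
  "Hm1 \<Omega> = {l. (\<forall>f\<in>H10 \<Omega>. \<forall>g\<in>H10 \<Omega>. l (\<lambda>x. f x + g x) = l f + l g) \<and>
                (\<forall>f\<in>H10 \<Omega>. \<forall>c. l (\<lambda>x. c * f x) = c * l f) \<and>
                (\<exists>M. \<forall>f\<in>H10 \<Omega>. \<bar>l f\<bar> \<le> M * H1_norm \<Omega> f)}"

definition Hm1_norm :: "'a::euclidean_space set \<Rightarrow> (('a \<Rightarrow> real) \<Rightarrow> real) \<Rightarrow> real" where
  "Hm1_norm \<Omega> l = (SUP f\<in>{f \<in> H10 \<Omega>. H1_norm \<Omega> f \<le> 1}. \<bar>l f\<bar>)"

definition continuous_on_L2 ::
  "'a::euclidean_space set \<Rightarrow> (('a \<Rightarrow> real) \<Rightarrow> ('a \<Rightarrow> real)) \<Rightarrow> bool" where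
  "continuous_on_L2 \<Omega> F \<longleftrightarrow>
     (\<forall>f\<in>L2 \<Omega>. \<forall>\<epsilon>>0. \<exists>\<delta>>0. \<forall>g\<in>L2 \<Omega>.
        L2_norm \<Omega> (\<lambda>x. g x - f x) < \<delta> \<longrightarrow> L2_norm \<Omega> (\<lambda>x. F g x - F f x) < \<epsilon>)"

definition bounded_on_bounded_L2 ::
  "'a::euclidean_space set \<Rightarrow> (('a \<Rightarrow> real) \<Rightarrow> ('a \<Rightarrow> real)) \<Rightarrow> bool" where
  "bounded_on_bounded_L2 \<Omega> F \<longleftrightarrow>
     (\<forall>R. \<exists>M. \<forall>f\<in>L2 \<Omega>. L2_norm \<Omega> f \<le> R \<longrightarrow> L2_norm \<Omega> (F f) \<le> M)"

definition locally_lipschitz_L2 ::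
  "'a::euclidean_space set \<Rightarrow> (('a \<Rightarrow> real) \<Rightarrow> ('a \<Rightarrow> real)) \<Rightarrow> bool" where
  "locally_lipschitz_L2 \<Omega> F \<longleftrightarrow>
     (\<forall>f\<in>L2 \<Omega>. \<exists>r>0. \<exists>L. \<forall>g\<in>L2 \<Omega>. \<forall>h\<in>L2 \<Omega>.
        L2_norm \<Omega> (\<lambda>x. g x - f x) < r \<longrightarrow> L2_norm \<Omega> (\<lambda>x. h x - f x) < r \<longrightarrow>
        L2_norm \<Omega> (\<lambda>x. F g x - F h x) \<le> L * L2_norm \<Omega> (\<lambda>x. g x - h x))"

text \<open>
  \<open>C_in J X p\<close> is \<open>C(J; X)\<close> for a space \<open>X\<close> of real-valued functions with norm \<open>p\<close>; \<open>X\<close> will be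
  \<open>L2 \<Omega>\<close> or \<open>H10 \<Omega>\<close>, or \<open>Hm1 \<Omega>\<close>, whose elements are real-valued functions on \<open>H10 \<Omega>\<close>.
\<close>

definition C_in ::
  "real set \<Rightarrow> ('x \<Rightarrow> real) set \<Rightarrow> (('x \<Rightarrow> real) \<Rightarrow> real) \<Rightarrow> (real \<Rightarrow> 'x \<Rightarrow> real) set" where
  "C_in J X p = {u. \<forall>t\<in>J. u t \<in> X \<and> ((\<lambda>s. p (\<lambda>x. u s x - u t x)) \<longlongrightarrow> 0) (at t within J)}"

definition has_derivative_in ::
  "real set \<Rightarrow> (('x \<Rightarrow> real) \<Rightarrow> real) \<Rightarrow> (real \<Rightarrow> 'x \<Rightarrow> real) \<Rightarrow> (real \<Rightarrow> 'x \<Rightarrow> real) \<Rightarrow> bool" where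
  "has_derivative_in J p u u' \<longleftrightarrow>
     (\<forall>t\<in>J. ((\<lambda>s. p (\<lambda>x. (u s x - u t x) / (s - t) - u' t x)) \<longlongrightarrow> 0) (at t within J))"

text \<open>
  The derivative \<open>ut\<close> of \<open>u\<close> is taken in \<open>L\<^sup>2(\<Omega>)\<close>, and \<open>utt\<close> is the derivative of \<open>ut\<close> in \<open>H\<^sup>-\<^sup>1(\<Omega>)\<close>,
  where \<open>f \<in> L\<^sup>2(\<Omega>)\<close> is identified with the functional \<open>L2_inner \<Omega> f\<close>. Since both derivatives
  are required to be continuous, they agree with the distributional ones.
\<close>

definition weak_solution ::
  "'a::euclidean_space set \<Rightarrow> real \<Rightarrow> real \<Rightarrow> (('a \<Rightarrow> real) \<Rightarrow> ('a \<Rightarrow> real)) \<Rightarrow>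
   ('a \<Rightarrow> real) \<Rightarrow> ('a \<Rightarrow> real) \<Rightarrow> real \<Rightarrow> (real \<Rightarrow> 'a \<Rightarrow> real) \<Rightarrow> bool" where
  "weak_solution \<Omega> \<nu> \<kappa> F u0 v0 T u \<longleftrightarrow>
     (\<exists>ut utt.
        u \<in> C_in {0..T} (H10 \<Omega>) (H1_norm \<Omega>) \<and>
        ut \<in> C_in {0..T} (L2 \<Omega>) (L2_norm \<Omega>) \<and>
        utt \<in> C_in {0..T} (Hm1 \<Omega>) (Hm1_norm \<Omega>) \<and>
        has_derivative_in {0..T} (L2_norm \<Omega>) u ut \<and>
        has_derivative_in {0..T} (Hm1_norm \<Omega>) (\<lambda>t. L2_inner \<Omega> (ut t)) utt \<and>
        ae_eq \<Omega> (u 0) u0 \<and> ae_eq \<Omega> (ut 0) v0 \<and>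
        (\<forall>\<phi>\<in>C_in {0..T} (H10 \<Omega>) (H1_norm \<Omega>). \<forall>t\<in>{0<..T}.
           utt t (\<phi> t) = - \<nu> * L2_inner \<Omega> (ut t) (\<phi> t)
             - \<kappa> * L2_inner \<Omega> (weak_grad \<Omega> (u t)) (weak_grad \<Omega> (\<phi> t))
             + L2_inner \<Omega> (F (u t)) (\<phi> t)))"

text \<open>
  Maximality: \<open>u\<close> on \<open>[0,\<tau>)\<close> is not the restriction of a weak solution on some \<open>[0,T]\<close> with
  \<open>\<tau> \<le> T\<close>. This also excludes extensions to a half-open interval \<open>[0,\<tau>')\<close> with \<open>\<tau> < \<tau>'\<close>, as
  they would restrict to a weak solution on \<open>[0,\<tau>]\<close>.
\<close>

definition maximal_solution ::
  "'a::euclidean_space set \<Rightarrow> real \<Rightarrow> real \<Rightarrow> (('a \<Rightarrow> real) \<Rightarrow> ('a \<Rightarrow> real)) \<Rightarrow>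
   ('a \<Rightarrow> real) \<Rightarrow> ('a \<Rightarrow> real) \<Rightarrow> ereal \<Rightarrow> (real \<Rightarrow> 'a \<Rightarrow> real) \<Rightarrow> bool" where
  "maximal_solution \<Omega> \<nu> \<kappa> F u0 v0 \<tau> u \<longleftrightarrow>
     0 < \<tau> \<and>
     (\<forall>T. 0 < T \<and> ereal T < \<tau> \<longrightarrow> weak_solution \<Omega> \<nu> \<kappa> F u0 v0 T u) \<and>
     \<not> (\<exists>T w. \<tau> \<le> ereal T \<and> weak_solution \<Omega> \<nu> \<kappa> F u0 v0 T w \<and>
          (\<forall>t. 0 \<le> t \<and> ereal t < \<tau> \<longrightarrow> ae_eq \<Omega> (w t) (u t)))"

end

theory Submission
  imports Defs
begin

text \<open>
  The difference \<open>w\<close> of two solutions solves the linear damped wave equation with a forcing \<open>f\<close> such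
  that \<open>\<parallel>f t\<parallel> \<le> L \<parallel>w t\<parallel>\<close>, with zero initial data. As \<open>w\<^sub>t\<close> is not an admissible test function, the
  standard energy identity is replaced by Ladyzhenskaya's: testing with \<open>\<integral>\<^sub>t\<^sup>s w\<close> gives
  \<open>\<parallel>w s\<parallel>\<^sup>2 \<le> L (\<integral>\<^sub>0\<^sup>s \<parallel>w\<parallel>)\<^sup>2\<close>, and \<open>w = 0\<close> by Gronwall. No vector-valued integral is needed: testing
  at time \<open>t\<close> with \<open>w r\<close> and integrating over \<open>t \<le> r\<close> leaves only scalar integrals.
\<close>

section \<open>Positive semidefinite kernels\<close>

text \<open>The obstacle is regularity: \<open>wt\<close> lies only in \<open>L2\<close>, so the
  Dirichlet form cannot be evaluated on it. Exchanging the order of integration over t \<le> r \<le>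
  s turns Ladyzhenskaya's test function into testing with the fixed element \<open>w r\<close>. At
  fixed r the Dirichlet term has no sign; its integral over the triangle has one, because the
  Riemann sums are halves of Gram sums up to a vanishing diagonal. The other terms are exact
  derivatives: pairing \<open>wt r\<close> with \<open>w r\<close> gives half the derivative of the
  squared norm, and the norm at r times its integral up to r is half the derivative of the square of
  that integral.

  A second obstacle is the encoding. \<open>weak_grad\<close> chooses an arbitrary representative,
  so even bilinearity of the Dirichlet form rests on uniqueness of weak gradients; the bump
  functions and the fundamental lemma of the calculus of variations serve this purpose. Integration
  by parts puts test functions into \<open>H1\<close>, without which \<open>H10\<close> could not be
  shown to be a linear space. Finally, L has to be one constant for the whole time interval,
  although the Lipschitz condition is local; compactness of the interval provides it.\<close>

lemma Riemann_sum_error: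
  fixes f :: "real \<Rightarrow> real" and h :: real and m :: nat
  assumes "0 \<le> h" and "continuous_on {0..m * h} f"
    and "\<And>(i::nat) x. i < m \<Longrightarrow> x \<in> {real i * h..(real i + 1) * h} \<Longrightarrow> \<bar>f x - f (i * h)\<bar> \<le> \<epsilon>"
  shows "\<bar>integral {0..m * h} f - h * (\<Sum>i<m. f (i * h))\<bar> \<le> \<epsilon> * (m * h)"
  using assms(2,3)
proof (induction m)
  case 0
  then show ?case by simp
next
  case (Suc m)
  let ?a = "real m * h" and ?b = "real (Suc m) * h"
  have ab: "0 \<le> ?a" "?a \<le> ?b" using \<open>0 \<le> h\<close> by (auto simp: mult_right_mono)
  have cb: "continuous_on {?a..?b} f"
    using ab by (intro continuous_on_subset[OF Suc.prems(1)]) auto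
  have ca: "continuous_on {0..?a} f"
    using ab by (intro continuous_on_subset[OF Suc.prems(1)]) auto
  have "integral {0..?a} f + integral {?a..?b} f = integral {0..?b} f"
    by (intro Henstock_Kurzweil_Integration.integral_combine ab integrable_continuous_real Suc.prems(1))
  moreover have "\<bar>integral {0..?a} f - h * (\<Sum>i<m. f (i * h))\<bar> \<le> \<epsilon> * (m * h)"
    using Suc.IH ca Suc.prems(2) by simp
  moreover have "\<bar>integral {?a..?b} f - h * f ?a\<bar> \<le> \<epsilon> * h"
  proof -
    have "integral {?a..?b} (\<lambda>x. f x - f ?a) = integral {?a..?b} f - integral {?a..?b} (\<lambda>x. f ?a)"
      using cb by (intro integral_diff) (auto intro: integrable_continuous_real)
    moreover have "norm (integral {?a..?b} (\<lambda>x. f x - f ?a)) \<le> \<epsilon> * (?b - ?a)"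
      using Suc.prems(2)[of m] by (intro integral_bound ab continuous_intros cb) (auto simp: add.commute)
    moreover have "?b - ?a = h" by (simp add: algebra_simps)
    ultimately show ?thesis using ab by simp
  qed
  ultimately show ?case by (simp add: algebra_simps abs_le_iff)
qed

lemma continuous_on_section:
  fixes K :: "real \<Rightarrow> real \<Rightarrow> real"
  assumes "continuous_on ({0..T} \<times> {0..T}) (\<lambda>(t, r). K t r)" and "r \<in> {0..T}" and "S \<subseteq> {0..T}"
  shows "continuous_on S (\<lambda>t. K t r)"
proof -
  have "continuous_on S (\<lambda>t. (\<lambda>(t, r). K t r) (t, r))"
    by (rule continuous_on_compose2[OF assms(1)]) (use assms in \<open>auto intro!: continuous_intros\<close>)
  then show ?thesis by simp
qed

text \<open>Both the upper limit and the integrand move with \<open>r\<close>. The substitution t =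
  r * \<sigma> fixes the domain to [0, 1], where continuity in a parameter is available; it remains
  valid at r = 0.\<close>

lemma continuous_on_triangle_integral:
  fixes K :: "real \<Rightarrow> real \<Rightarrow> real"
  assumes "continuous_on ({0..T} \<times> {0..T}) (\<lambda>(t, r). K t r)"
  shows "continuous_on {0..T} (\<lambda>r. integral {0..r} (\<lambda>t. K t r))"
proof -
  have "integral {0..r} (\<lambda>t. K t r) = r * integral (cbox 0 1) (\<lambda>\<sigma>. K (r * \<sigma>) r)" if "r \<in> {0..T}" for r
  proof -
    have "continuous_on {0..r} (\<lambda>t. K t r)"
      using that by (intro continuous_on_section[OF assms]) auto
    then have "((\<lambda>\<sigma>. r *\<^sub>R K (r * \<sigma>) r) has_integral integral {r * 0..r * 1} (\<lambda>t. K t r)) {0..1}"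
      using that by (intro has_integral_substitution[where c = 0 and d = r])
        (auto intro!: derivative_eq_intros simp: mult_left_le)
    from integral_unique[OF this] show ?thesis by simp
  qed
  moreover have "continuous_on {0..T} (\<lambda>r. r * integral (cbox 0 1) (\<lambda>\<sigma>. K (r * \<sigma>) r))"
  proof (intro continuous_intros integral_continuous_on_param)
    show "continuous_on ({0..T} \<times> cbox 0 1) (\<lambda>(r, \<sigma>). K (r * \<sigma>) r)"
      unfolding split_def
      by (rule continuous_on_compose2[OF assms, of _ "\<lambda>p. (fst p * snd p, fst p)", simplified])
        (auto intro!: continuous_intros intro: order_trans[OF mult_left_le])
  qed
  ultimately show ?thesis by (subst continuous_on_cong[OF refl]) auto
qed

lemma sum_triangle_symmetric:
  fixes k :: "nat \<Rightarrow> nat \<Rightarrow> real"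
  assumes "\<And>i j. k i j = k j i"
  shows "2 * (\<Sum>i<n. \<Sum>j<i. k j i) = (\<Sum>i<n. \<Sum>j<n. k j i) - (\<Sum>i<n. k i i)"
proof (induction n)
  case (Suc n)
  have "(\<Sum>i<Suc n. \<Sum>j<Suc n. k j i) = (\<Sum>i<n. \<Sum>j<n. k j i) + 2 * (\<Sum>j<n. k j n) + k n n"
    using assms by (simp add: sum.distrib)
  then show ?case using Suc by simp
qed simp

text \<open>Left endpoint sums on one uniform grid of width h turn the iterated integral into h^2
  times the sum of \<open>K\<close> over the strict triangle j < i. By symmetry this is half of the
  full square sum, which \<open>psd\<close> makes nonnegative, minus half of the diagonal, whose
  share is of order h. Unit coefficients suffice in \<open>psd\<close> because the grid is
  uniform.\<close>

lemma psd_kernel_triangle_integral_nonneg: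
  fixes K :: "real \<Rightarrow> real \<Rightarrow> real"
  assumes "0 \<le> T" and cont: "continuous_on ({0..T} \<times> {0..T}) (\<lambda>(t, r). K t r)"
    and sym: "\<And>t r. K t r = K r t"
    and psd: "\<And>(n::nat) x. (\<And>i. i < n \<Longrightarrow> x i \<in> {0..T}) \<Longrightarrow> 0 \<le> (\<Sum>i<n. \<Sum>j<n. K (x j) (x i))"
  shows "0 \<le> integral {0..T} (\<lambda>r. integral {0..r} (\<lambda>t. K t r))"
proof (cases "T = 0")
  case False
  with \<open>0 \<le> T\<close> have "T > 0" by simp
  define g where "g = (\<lambda>r. integral {0..r} (\<lambda>t. K t r))"
  have cg: "continuous_on {0..T} g"
    unfolding g_def by (rule continuous_on_triangle_integral[OF cont])
  have cK: "continuous_on {0..r} (\<lambda>t. K t r)" if "r \<in> {0..T}" for r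
    using that by (intro continuous_on_section[OF cont]) auto
  have "compact ((\<lambda>(t, r). K t r) ` ({0..T} \<times> {0..T}))"
    using cont by (intro compact_continuous_image compact_Times) auto
  then obtain M where M: "\<And>t r. t \<in> {0..T} \<Longrightarrow> r \<in> {0..T} \<Longrightarrow> \<bar>K t r\<bar> \<le> M"
    by (force dest!: compact_imp_bounded simp: bounded_iff)
  \<comment> \<open>In this order, the terms of the factor bound the diagonal, the quadrature error
    of the outer integral, and the quadrature errors of the inner integrals summed with weight
    h.\<close>
  have lb: "integral {0..T} g \<ge> - (\<epsilon> * (T * M + T + T * T))" if "\<epsilon> > 0" for \<epsilon>
  proof -
    have "uniformly_continuous_on ({0..T} \<times> {0..T}) (\<lambda>(t, r). K t r)"
      using cont by (intro compact_uniformly_continuous compact_Times) auto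
    then obtain d1 where d1: "d1 > 0"
      "\<And>p q. p \<in> {0..T} \<times> {0..T} \<Longrightarrow> q \<in> {0..T} \<times> {0..T} \<Longrightarrow> dist p q < d1 \<Longrightarrow>
        dist (case p of (t, r) \<Rightarrow> K t r) (case q of (t, r) \<Rightarrow> K t r) < \<epsilon>"
      using \<open>\<epsilon> > 0\<close> unfolding uniformly_continuous_on_def by metis
    have "uniformly_continuous_on {0..T} g"
      using cg by (intro compact_uniformly_continuous) auto
    then obtain d2 where d2: "d2 > 0"
      "\<And>p q. p \<in> {0..T} \<Longrightarrow> q \<in> {0..T} \<Longrightarrow> dist p q < d2 \<Longrightarrow> dist (g p) (g q) < \<epsilon>"
      using \<open>\<epsilon> > 0\<close> unfolding uniformly_continuous_on_def by metis
    \<comment> \<open>A grid width below \<open>d1\<close> controls the inner integrands, below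
      \<open>d2\<close> the outer function \<open>g\<close>, and below \<open>\<epsilon>\<close> the
      diagonal.\<close>
    define d where "d = min \<epsilon> (min d1 d2)"
    have "d > 0" using d1 d2 \<open>\<epsilon> > 0\<close> by (simp add: d_def)
    obtain n where n: "T / d < real n" using reals_Archimedean2 by blast
    then have "n > 0" using \<open>T > 0\<close> \<open>d > 0\<close> by (intro gr0I) (auto simp: divide_less_0_iff)
    define h where "h = T / n"
    have h: "h > 0" "h < d" "n * h = T"
      using n \<open>T > 0\<close> \<open>d > 0\<close> \<open>n > 0\<close> by (auto simp: h_def field_simps)
    have grid: "real i * h \<in> {0..T}" if "i \<le> n" for i
      using that h(1) h(3)[symmetric] by (auto intro: mult_right_mono)
    have cell: "x \<in> {0..T} \<and> \<bar>x - real i * h\<bar> < d" if "i < n" "x \<in> {real i * h..(real i + 1) * h}" for i x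
      using that grid[of i] grid[of "Suc i"] h
      by (auto simp: algebra_simps intro: order_trans[of _ "h * real i"])
    have "\<bar>integral {0..n * h} g - h * (\<Sum>i<n. g (real i * h))\<bar> \<le> \<epsilon> * (real n * h)"
    proof (rule Riemann_sum_error)
      show "\<bar>g x - g (real i * h)\<bar> \<le> \<epsilon>" if "i < n" "x \<in> {real i * h..(real i + 1) * h}" for i x
        using d2(2)[of x "real i * h"] cell[of i x] that grid[of i]
        by (auto simp: dist_real_def d_def intro: less_imp_le)
    qed (use h cg in auto)
    then have outer: "integral {0..T} g \<ge> h * (\<Sum>i<n. g (real i * h)) - \<epsilon> * T"
      using h by (simp add: abs_le_iff)
    have inner: "g (real i * h) \<ge> h * (\<Sum>j<i. K (real j * h) (real i * h)) - \<epsilon> * T" if "i < n" for i :: nat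
    proof -
      have "\<bar>integral {0..i * h} (\<lambda>t. K t (real i * h)) - h * (\<Sum>j<i. K (real j * h) (real i * h))\<bar> \<le> \<epsilon> * (real i * h)"
      proof (rule Riemann_sum_error)
        show "\<bar>K x (real i * h) - K (real j * h) (real i * h)\<bar> \<le> \<epsilon>" if "j < i" "x \<in> {real j * h..(real j + 1) * h}" for j x
          using d1(2)[of "(x, real i * h)" "(real j * h, real i * h)"] cell[of j x] that \<open>i < n\<close> grid[of i] grid[of j]
          by (auto simp: dist_Pair_Pair dist_real_def d_def intro: less_imp_le)
      qed (use h grid[of i] cK that in auto)
      moreover have "\<epsilon> * (real i * h) \<le> \<epsilon> * T" using grid[of i] that \<open>\<epsilon> > 0\<close> by simp
      ultimately show ?thesis unfolding g_def by (simp add: abs_le_iff)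
    qed
    have "2 * (\<Sum>i<n. \<Sum>j<i. K (real j * h) (real i * h)) \<ge> - (\<Sum>i<n. K (real i * h) (real i * h))"
      using sum_triangle_symmetric[of "\<lambda>i j. K (real i * h) (real j * h)" n] psd[of n "\<lambda>i. real i * h"] grid sym
      by (simp add: less_imp_le)
    moreover have "(\<Sum>i<n. K (real i * h) (real i * h)) \<le> real n * M"
      using sum_bounded_above[of "{..<n}" "\<lambda>i. K (real i * h) (real i * h)" M] M grid by (force simp: abs_le_iff)
    \<comment> \<open>This permits weakening the sharp bound - n M / 2 to - n M.\<close>
    moreover have "0 \<le> real n * M"
      using M[of 0 0] \<open>T > 0\<close> by simp
    ultimately have tri: "(\<Sum>i<n. \<Sum>j<i. K (real j * h) (real i * h)) \<ge> - (real n * M)"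
      by linarith
    have "(\<Sum>i<n. g (real i * h)) \<ge> (\<Sum>i<n. h * (\<Sum>j<i. K (real j * h) (real i * h)) - \<epsilon> * T)"
      by (intro sum_mono inner) auto
    also have "(\<Sum>i<n. h * (\<Sum>j<i. K (real j * h) (real i * h)) - \<epsilon> * T)
        = h * (\<Sum>i<n. \<Sum>j<i. K (real j * h) (real i * h)) - real n * (\<epsilon> * T)"
      by (simp add: sum_subtractf sum_distrib_left)
    finally have "(\<Sum>i<n. g (real i * h)) \<ge> h * (- (real n * M)) - real n * (\<epsilon> * T)"
      using mult_left_mono[OF tri, of h] h by linarith
    then have "h * (\<Sum>i<n. g (real i * h)) \<ge> h * (h * (- (real n * M)) - real n * (\<epsilon> * T))"
      using h by simp
    also have "h * (h * (- (real n * M)) - real n * (\<epsilon> * T)) = - (h * ((real n * h) * M)) - (real n * h) * (\<epsilon> * T)"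
      by (simp add: algebra_simps)
    finally have "integral {0..T} g \<ge> - (h * (T * M)) - T * (\<epsilon> * T) - \<epsilon> * T"
      using outer h(3) by simp
    moreover have "h * (T * M) \<le> \<epsilon> * (T * M)"
      using h M[of 0 0] \<open>T > 0\<close> by (intro mult_right_mono) (auto simp: d_def)
    ultimately show ?thesis by (simp add: algebra_simps)
  qed
  let ?C = "T * M + T + T * T"
  have "?C > 0" using M[of 0 0] \<open>T > 0\<close> by (simp add: add_nonneg_pos add_pos_nonneg)
  have "0 \<le> integral {0..T} g + e" if "e > 0" for e
  proof -
    have "- e \<le> integral {0..T} g" using lb[of "e / ?C"] that \<open>?C > 0\<close> by simp
    then show ?thesis by linarith
  qed
  then have "0 \<le> integral {0..T} g"
    by (rule field_le_epsilon)
  then show ?thesis by (simp add: g_def)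
qed simp

section \<open>Curves in semi-inner product spaces\<close>

text \<open>Elements are representatives of almost-everywhere classes, so a form is only
  semidefinite and lives on a carrier set rather than on a type. The abstraction covers the inner
  product of \<open>L2\<close> and, on \<open>H1\<close> and \<open>H10\<close>, both the full inner
  product and the Dirichlet form alone.\<close>

locale semi_inner_space =
  fixes X :: "('x \<Rightarrow> real) set" and B :: "('x \<Rightarrow> real) \<Rightarrow> ('x \<Rightarrow> real) \<Rightarrow> real"
  assumes zero_mem: "(\<lambda>x. 0) \<in> X"
    and add_mem: "f \<in> X \<Longrightarrow> g \<in> X \<Longrightarrow> (\<lambda>x. f x + g x) \<in> X"
    and scale_mem: "f \<in> X \<Longrightarrow> (\<lambda>x. c * f x) \<in> X"
    and add_left: "f \<in> X \<Longrightarrow> g \<in> X \<Longrightarrow> h \<in> X \<Longrightarrow> B (\<lambda>x. f x + g x) h = B f h + B g h"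
    and scale_left: "f \<in> X \<Longrightarrow> h \<in> X \<Longrightarrow> B (\<lambda>x. c * f x) h = c * B f h"
    and sym: "B f g = B g f"
    and nonneg: "f \<in> X \<Longrightarrow> 0 \<le> B f f"
begin

definition N :: "('x \<Rightarrow> real) \<Rightarrow> real" where
  "N f = sqrt (B f f)"

lemma diff_mem: "f \<in> X \<Longrightarrow> g \<in> X \<Longrightarrow> (\<lambda>x. f x - g x) \<in> X"
  using add_mem[of f "\<lambda>x. (-1) * g x"] scale_mem[of g "-1"] by simp

lemma divide_mem: "f \<in> X \<Longrightarrow> (\<lambda>x. f x / c) \<in> X"
  using scale_mem[of f "inverse c"] by (simp add: field_simps)

lemma diff_left:
  assumes "f \<in> X" "g \<in> X" "h \<in> X"
  shows "B (\<lambda>x. f x - g x) h = B f h - B g h"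
  using add_left[of f "\<lambda>x. (-1) * g x" h] scale_mem[of g "-1"] scale_left[of g h "-1"] assms by simp

lemma divide_left: "f \<in> X \<Longrightarrow> h \<in> X \<Longrightarrow> B (\<lambda>x. f x / c) h = B f h / c"
  using scale_left[of f h "inverse c"] by (simp add: field_simps)

lemma add_right: "f \<in> X \<Longrightarrow> g \<in> X \<Longrightarrow> h \<in> X \<Longrightarrow> B h (\<lambda>x. f x + g x) = B h f + B h g"
  using add_left sym by metis

lemma diff_right: "f \<in> X \<Longrightarrow> g \<in> X \<Longrightarrow> h \<in> X \<Longrightarrow> B h (\<lambda>x. f x - g x) = B h f - B h g"
  using diff_left sym by metis

lemma scale_right: "f \<in> X \<Longrightarrow> h \<in> X \<Longrightarrow> B h (\<lambda>x. c * f x) = c * B h f"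
  using scale_left sym by metis

lemma sum_mem: "(\<And>i. i < n \<Longrightarrow> f i \<in> X) \<Longrightarrow> (\<lambda>x. \<Sum>i<(n::nat). f i x) \<in> X"
  by (induction n) (auto intro!: zero_mem add_mem)

lemma sum_left:
  "(\<And>i. i < n \<Longrightarrow> f i \<in> X) \<Longrightarrow> h \<in> X \<Longrightarrow> B (\<lambda>x. \<Sum>i<(n::nat). f i x) h = (\<Sum>i<n. B (f i) h)"
proof (induction n)
  case 0
  then show ?case using scale_left[of "\<lambda>x. 0" h 0] zero_mem by simp
next
  case (Suc n)
  then show ?case using add_left[of "\<lambda>x. \<Sum>i<n. f i x" "f n" h] sum_mem[of n f] by simp
qed

text \<open>The double sum is \<open>B\<close> of the sum of all \<open>f i\<close> with itself. It
  supplies the positivity hypothesis of \<open>psd_kernel_triangle_integral_nonneg\<close> for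
  kernels of the form \<open>B (w t) (w r)\<close>.\<close>

lemma gram_nonneg:
  assumes "\<And>i. i < n \<Longrightarrow> f i \<in> X"
  shows "0 \<le> (\<Sum>i<(n::nat). \<Sum>j<n. B (f j) (f i))"
proof -
  let ?s = "\<lambda>x. \<Sum>i<n. f i x"
  have "B ?s ?s = (\<Sum>i<n. B (f i) ?s)"
    using assms sum_mem[of n f] by (intro sum_left) auto
  also have "\<dots> = (\<Sum>i<n. \<Sum>j<n. B (f j) (f i))"
    using assms by (intro sum.cong refl) (subst sym, subst sum_left, auto)
  finally show ?thesis using nonneg sum_mem assms by metis
qed

lemma N_nonneg: "f \<in> X \<Longrightarrow> 0 \<le> N f"
  by (simp add: N_def nonneg)

lemma N_square: "f \<in> X \<Longrightarrow> (N f)\<^sup>2 = B f f"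
  by (simp add: N_def nonneg)

lemma N_scale: "f \<in> X \<Longrightarrow> N (\<lambda>x. c * f x) = \<bar>c\<bar> * N f"
  by (simp add: N_def scale_left scale_right scale_mem real_sqrt_mult flip: mult.assoc)

lemma N_zero: "N (\<lambda>x. 0) = 0"
  using N_scale[OF zero_mem, of 0] by simp

lemma N_minus_commute: "f \<in> X \<Longrightarrow> g \<in> X \<Longrightarrow> N (\<lambda>x. f x - g x) = N (\<lambda>x. g x - f x)"
  using N_scale[of "\<lambda>x. f x - g x" "-1"] diff_mem[of f g] by simp

lemma Cauchy_Schwarz:
  assumes "f \<in> X" "g \<in> X"
  shows "\<bar>B f g\<bar> \<le> N f * N g"
proof -
  have q: "0 \<le> B f f - 2 * c * B f g + c\<^sup>2 * B g g" for c
    using nonneg[OF diff_mem[OF \<open>f \<in> X\<close> scale_mem[OF \<open>g \<in> X\<close>]], of c] assms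
    by (simp add: diff_left diff_right scale_left scale_right scale_mem diff_mem sym[of g f] power2_eq_square
        algebra_simps)
  have "(B f g)\<^sup>2 \<le> B f f * B g g"
  proof (cases "B g g = 0")
    case True
    have "B f g = 0"
    proof (rule ccontr)
      assume "B f g \<noteq> 0"
      \<comment> \<open>The expression in \<open>q\<close> is affine in the parameter here, and this
        value makes it equal to -1.\<close>
      then show False using q[of "(B f f + 1) / (2 * B f g)"] True by simp
    qed
    then show ?thesis using True by simp
  next
    case False
    then have "B g g > 0" using nonneg[OF \<open>g \<in> X\<close>] by simp
    then show ?thesis using q[of "B f g / B g g"] by (simp add: field_simps power2_eq_square)
  qed
  then have "sqrt ((B f g)\<^sup>2) \<le> sqrt (B f f * B g g)" by (rule real_sqrt_le_mono)
  then show ?thesis by (simp add: N_def real_sqrt_mult)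
qed

lemma N_triangle:
  assumes "f \<in> X" "g \<in> X"
  shows "N (\<lambda>x. f x + g x) \<le> N f + N g"
proof (rule power2_le_imp_le)
  have "(N (\<lambda>x. f x + g x))\<^sup>2 = (N f)\<^sup>2 + 2 * B f g + (N g)\<^sup>2"
    using assms by (simp add: N_square add_mem add_left add_right sym[of g f])
  also have "\<dots> \<le> (N f + N g)\<^sup>2"
    using Cauchy_Schwarz[OF assms] by (simp add: power2_sum abs_le_iff)
  finally show "(N (\<lambda>x. f x + g x))\<^sup>2 \<le> (N f + N g)\<^sup>2" .
qed (use assms N_nonneg in auto)

lemma N_diff_le:
  assumes "f \<in> X" "g \<in> X"
  shows "N (\<lambda>x. f x - g x) \<le> N f + N g"
  using N_triangle[OF assms(1) scale_mem[OF assms(2), of "-1"]] N_scale[OF assms(2), of "-1"] by simp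

text \<open>Expanding around the limits leaves the product of both errors and two mixed terms, each
  bounded by Cauchy-Schwarz. Membership is required only eventually, since along
  \<open>at t within J\<close> nothing is known about a curve outside \<open>J\<close>.\<close>

lemma tendsto_B:
  assumes mem: "\<forall>\<^sub>F z in G. u z \<in> X" "\<forall>\<^sub>F z in G. v z \<in> X" "a \<in> X" "b \<in> X"
    and lim: "((\<lambda>z. N (\<lambda>x. u z x - a x)) \<longlongrightarrow> 0) G" "((\<lambda>z. N (\<lambda>x. v z x - b x)) \<longlongrightarrow> 0) G"
  shows "((\<lambda>z. B (u z) (v z)) \<longlongrightarrow> B a b) G"
proof (rule LIM_zero_cancel, rule tendsto_0_le[where K = 1])
  let ?p = "\<lambda>z. N (\<lambda>x. u z x - a x)" and ?q = "\<lambda>z. N (\<lambda>x. v z x - b x)"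
  show "((\<lambda>z. ?p z * ?q z + ?p z * N b + N a * ?q z) \<longlongrightarrow> 0) G"
    using tendsto_add[OF tendsto_add[OF tendsto_mult[OF lim] tendsto_mult[OF lim(1) tendsto_const]]
        tendsto_mult[OF tendsto_const lim(2)]] by simp
  show "\<forall>\<^sub>F z in G. norm (B (u z) (v z) - B a b)
      \<le> norm (?p z * ?q z + ?p z * N b + N a * ?q z) * 1"
    using mem(1,2)
  proof eventually_elim
    case (elim z)
    let ?u = "\<lambda>x. u z x - a x" and ?v = "\<lambda>x. v z x - b x"
    have m: "?u \<in> X" "?v \<in> X" using elim mem diff_mem by auto
    have "B (u z) (v z) - B a b = B ?u ?v + B ?u b + B a ?v"
      using elim mem m by (simp add: diff_left diff_right)
    then show ?case
      using Cauchy_Schwarz[OF m] Cauchy_Schwarz[OF m(1) \<open>b \<in> X\<close>] Cauchy_Schwarz[OF \<open>a \<in> X\<close> m(2)]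
      by simp
  qed
qed

section \<open>Continuity and differentiation of pairings along curves\<close>

lemma C_in_mem: "u \<in> C_in J X N \<Longrightarrow> t \<in> J \<Longrightarrow> u t \<in> X"
  by (simp add: C_in_def)

lemma C_in_diff:
  assumes "u \<in> C_in J X N" "v \<in> C_in J X N"
  shows "(\<lambda>t x. u t x - v t x) \<in> C_in J X N"
  unfolding C_in_def
proof (intro CollectI ballI conjI)
  fix t assume t: "t \<in> J"
  have mem: "u s \<in> X" "v s \<in> X" if "s \<in> J" for s using assms that C_in_mem by auto
  then show "(\<lambda>x. u t x - v t x) \<in> X" using t diff_mem by auto
  show "((\<lambda>s. N (\<lambda>x. u s x - v s x - (u t x - v t x))) \<longlongrightarrow> 0) (at t within J)"
  proof (rule tendsto_0_le[where K = 1])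
    show "((\<lambda>s. N (\<lambda>x. u s x - u t x) + N (\<lambda>x. v s x - v t x)) \<longlongrightarrow> 0) (at t within J)"
      using tendsto_add[of _ 0 _ _ 0] assms t unfolding C_in_def by fastforce
    have "N (\<lambda>x. u s x - v s x - (u t x - v t x)) \<le> N (\<lambda>x. u s x - u t x) + N (\<lambda>x. v s x - v t x)"
      if "s \<in> J" for s
      using N_triangle[of "\<lambda>x. u s x - u t x" "\<lambda>x. v t x - v s x"] N_minus_commute[of "v s" "v t"]
        mem[OF that] mem[OF t] diff_mem by (simp add: algebra_simps)
    then show "\<forall>\<^sub>F s in at t within J. norm (N (\<lambda>x. u s x - v s x - (u t x - v t x)))
        \<le> norm (N (\<lambda>x. u s x - u t x) + N (\<lambda>x. v s x - v t x)) * 1"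
      using mem t diff_mem N_nonneg by (auto simp: eventually_at_filter intro!: always_eventually)
  qed
qed

lemma has_derivative_in_diff:
  assumes mem: "\<And>t. t \<in> J \<Longrightarrow> u t \<in> X" "\<And>t. t \<in> J \<Longrightarrow> v t \<in> X"
    "\<And>t. t \<in> J \<Longrightarrow> u' t \<in> X" "\<And>t. t \<in> J \<Longrightarrow> v' t \<in> X"
    and "has_derivative_in J N u u'" "has_derivative_in J N v v'"
  shows "has_derivative_in J N (\<lambda>t x. u t x - v t x) (\<lambda>t x. u' t x - v' t x)"
  unfolding has_derivative_in_def
proof
  fix t assume t: "t \<in> J"
  let ?U = "\<lambda>s x. (u s x - u t x) / (s - t) - u' t x"
  let ?V = "\<lambda>s x. (v s x - v t x) / (s - t) - v' t x"
  let ?W = "\<lambda>s x. (u s x - v s x - (u t x - v t x)) / (s - t) - (u' t x - v' t x)"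
  have m: "?U s \<in> X" "?V s \<in> X" "?W s \<in> X" if "s \<in> J" for s
    using mem t that by (auto intro!: diff_mem divide_mem)
  show "((\<lambda>s. N (?W s)) \<longlongrightarrow> 0) (at t within J)"
  proof (rule tendsto_0_le[where K = 1])
    show "((\<lambda>s. N (?U s) + N (?V s)) \<longlongrightarrow> 0) (at t within J)"
      using tendsto_add[of _ 0 _ _ 0] assms t unfolding has_derivative_in_def by fastforce
    have "N (?W s) \<le> N (?U s) + N (?V s)" if "s \<in> J" for s
    proof -
      have "?W s = (\<lambda>x. ?U s x - ?V s x)" by (auto simp: diff_divide_distrib)
      moreover have "N (\<lambda>x. ?U s x - ?V s x) \<le> N (?U s) + N (?V s)"
        by (rule N_diff_le[OF m(1)[OF that] m(2)[OF that]])
      ultimately show ?thesis by simp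
    qed
    then show "\<forall>\<^sub>F s in at t within J. norm (N (?W s)) \<le> norm (N (?U s) + N (?V s)) * 1"
      using m N_nonneg by (auto simp: eventually_at_filter intro!: always_eventually)
  qed
qed

lemma continuous_on_B:
  assumes "u \<in> C_in J X N" "v \<in> C_in J X N"
  shows "continuous_on (J \<times> J) (\<lambda>(s, t). B (u s) (v t))"
  unfolding continuous_on_def
proof
  fix z assume "z \<in> J \<times> J"
  then obtain s t where z: "z = (s, t)" and st: "s \<in> J" "t \<in> J" by blast
  let ?G = "at (s, t) within J \<times> J"
  have G1: "\<forall>\<^sub>F z in ?G. fst z \<in> J" and G2: "\<forall>\<^sub>F z in ?G. snd z \<in> J"
    by (auto simp: eventually_at_filter intro!: always_eventually)
  \<comment> \<open>The limit in \<open>C_in\<close> ignores the point \<open>s\<close> itself, but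
    a point of the square near (s, t) may share a coordinate with it. Hence continuity is needed,
    including the value \<open>N (\<lambda>x. 0) = 0\<close> at the centre.\<close>
  have c1: "continuous (at s within J) (\<lambda>r. N (\<lambda>x. u r x - u s x))"
    and c2: "continuous (at t within J) (\<lambda>r. N (\<lambda>x. v r x - v t x))"
    using assms st unfolding continuous_within by (simp_all add: C_in_def N_zero)
  have "(fst \<longlongrightarrow> s) ?G" "(snd \<longlongrightarrow> t) ?G"
    using tendsto_fst[OF tendsto_ident_at, of "(s, t)" "J \<times> J"]
      tendsto_snd[OF tendsto_ident_at, of "(s, t)" "J \<times> J"] by simp_all
  note lims = continuous_within_tendsto_compose[OF c1 G1 this(1)]
    continuous_within_tendsto_compose[OF c2 G2 this(2)]
  have "((\<lambda>z. B (u (fst z)) (v (snd z))) \<longlongrightarrow> B (u s) (v t)) ?G"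
  proof (rule tendsto_B)
    show "\<forall>\<^sub>F z in ?G. u (fst z) \<in> X" "\<forall>\<^sub>F z in ?G. v (snd z) \<in> X"
      using G1 G2 C_in_mem[OF assms(1)] C_in_mem[OF assms(2)] by (auto elim: eventually_mono)
  qed (use lims N_zero assms st C_in_mem in auto)
  then show "((\<lambda>(s, t). B (u s) (v t)) \<longlongrightarrow> (case z of (s, t) \<Rightarrow> B (u s) (v t))) (at z within J \<times> J)"
    by (simp add: split_def z)
qed

lemma continuous_on_B_diag:
  assumes "u \<in> C_in J X N" "v \<in> C_in J X N"
  shows "continuous_on J (\<lambda>t. B (u t) (v t))"
proof -
  have "continuous_on J (\<lambda>t. (\<lambda>(s, t). B (u s) (v t)) (t, t))"
    by (rule continuous_on_compose2[OF continuous_on_B[OF assms]]) (auto intro!: continuous_intros)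
  then show ?thesis by simp
qed

lemma const_in_C_in: "f \<in> X \<Longrightarrow> (\<lambda>t. f) \<in> C_in J X N"
  by (simp add: C_in_def N_zero)

lemma continuous_on_N: "u \<in> C_in J X N \<Longrightarrow> continuous_on J (\<lambda>t. N (u t))"
  using continuous_on_real_sqrt[OF continuous_on_B_diag[of u J u]] by (simp add: N_def)

text \<open>By symmetry a difference of squares factors: the quotient of
  \<open>B (u s) (u s)\<close> is \<open>B\<close> of the difference quotient of \<open>u\<close>
  with \<open>u s\<close>, plus \<open>B\<close> of it with \<open>u t\<close>. Both tend to
  \<open>B (u' t) (u t)\<close>.\<close>

lemma has_real_derivative_B_self:
  assumes "u \<in> C_in J X N" "\<And>t. t \<in> J \<Longrightarrow> u' t \<in> X" "has_derivative_in J N u u'" "t \<in> J"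
  shows "((\<lambda>s. B (u s) (u s)) has_real_derivative 2 * B (u' t) (u t)) (at t within J)"
proof -
  have mem: "u s \<in> X" if "s \<in> J" for s using assms that C_in_mem by auto
  let ?G = "at t within J"
  have G: "\<forall>\<^sub>F s in ?G. s \<in> J \<and> s \<noteq> t" by (auto simp: eventually_at_filter)
  have lim: "((\<lambda>s. N (\<lambda>x. u s x - u t x)) \<longlongrightarrow> 0) ?G"
    "((\<lambda>s. N (\<lambda>x. (u s x - u t x) / (s - t) - u' t x)) \<longlongrightarrow> 0) ?G"
    using assms by (auto simp: C_in_def has_derivative_in_def)
  have "((\<lambda>s. B (\<lambda>x. (u s x - u t x) / (s - t)) (u s)) \<longlongrightarrow> B (u' t) (u t)) ?G"
    "((\<lambda>s. B (\<lambda>x. (u s x - u t x) / (s - t)) (u t)) \<longlongrightarrow> B (u' t) (u t)) ?G"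
    using G assms mem lim const_in_C_in[of "u t" J, unfolded C_in_def]
    by (auto intro!: tendsto_B diff_mem divide_mem elim: eventually_mono)
  then have "((\<lambda>s. B (\<lambda>x. (u s x - u t x) / (s - t)) (u s) + B (\<lambda>x. (u s x - u t x) / (s - t)) (u t))
      \<longlongrightarrow> 2 * B (u' t) (u t)) ?G"
    using tendsto_add by fastforce
  then have "((\<lambda>s. (B (u s) (u s) - B (u t) (u t)) / (s - t)) \<longlongrightarrow> 2 * B (u' t) (u t)) ?G"
  proof (rule Lim_transform_eventually)
    show "\<forall>\<^sub>F s in ?G. B (\<lambda>x. (u s x - u t x) / (s - t)) (u s) + B (\<lambda>x. (u s x - u t x) / (s - t)) (u t)
        = (B (u s) (u s) - B (u t) (u t)) / (s - t)"
      using G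
    proof eventually_elim
      case (elim s)
      then show ?case
        using mem[of s] mem[OF \<open>t \<in> J\<close>]
        by (simp add: divide_left diff_mem diff_left sym[of "u t" "u s"] flip: add_divide_distrib)
    qed
  qed
  then show ?thesis by (simp add: has_field_derivative_iff)
qed

lemma has_real_derivative_B:
  assumes "\<And>t. t \<in> J \<Longrightarrow> u t \<in> X" "\<And>t. t \<in> J \<Longrightarrow> u' t \<in> X" "has_derivative_in J N u u'" "t \<in> J" "f \<in> X"
  shows "((\<lambda>s. B (u s) f) has_real_derivative B (u' t) f) (at t within J)"
proof -
  let ?G = "at t within J"
  have G: "\<forall>\<^sub>F s in ?G. s \<in> J \<and> s \<noteq> t" by (auto simp: eventually_at_filter)
  have "((\<lambda>s. N (\<lambda>x. (u s x - u t x) / (s - t) - u' t x)) \<longlongrightarrow> 0) ?G"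
    using assms by (auto simp: has_derivative_in_def)
  then have "((\<lambda>s. B (\<lambda>x. (u s x - u t x) / (s - t)) f) \<longlongrightarrow> B (u' t) f) ?G"
    using G assms const_in_C_in[of f J, unfolded C_in_def]
    by (auto intro!: tendsto_B diff_mem divide_mem elim: eventually_mono)
  then have "((\<lambda>s. (B (u s) f - B (u t) f) / (s - t)) \<longlongrightarrow> B (u' t) f) ?G"
  proof (rule Lim_transform_eventually)
    show "\<forall>\<^sub>F s in ?G. B (\<lambda>x. (u s x - u t x) / (s - t)) f = (B (u s) f - B (u t) f) / (s - t)"
      using G by eventually_elim (use assms in \<open>simp add: divide_left diff_left diff_mem\<close>)
  qed
  then show ?thesis by (simp add: has_field_derivative_iff)
qed

end

section \<open>The energy estimate\<close>

text \<open>With \<open>Y\<close> the integral of \<open>n\<close>, the inequality says Y' \<le> c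
  Y, so the integrating factor makes \<open>exp (- c * s) * Y s\<close> nonincreasing from 0. Then
  \<open>Y t \<le> 0\<close>, which squeezes \<open>n t\<close> between 0 and 0.\<close>

lemma Gronwall_zero:
  fixes n :: "real \<Rightarrow> real"
  assumes cont: "continuous_on {0..T} n"
    and le: "\<And>t. t \<in> {0..T} \<Longrightarrow> n t \<le> c * integral {0..t} n"
    and nonneg: "\<And>t. t \<in> {0..T} \<Longrightarrow> 0 \<le> n t" and "0 \<le> c" and "t \<in> {0..T}"
  shows "n t = 0"
proof -
  define Y where "Y = (\<lambda>t. integral {0..t} n)"
  have dY: "(Y has_real_derivative n s) (at s within {0..T})" if "s \<in> {0..T}" for s
    unfolding Y_def using integral_has_real_derivative[OF cont that] .
  let ?E = "\<lambda>s. exp (- c * s) * Y s"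
  have dE: "(?E has_real_derivative exp (- c * s) * (n s - c * Y s)) (at s within {0..T})"
    if "s \<in> {0..T}" for s
    using dY[OF that] by (auto intro!: derivative_eq_intros simp: algebra_simps)
  have "?E t \<le> ?E 0"
  proof (rule DERIV_nonpos_imp_decreasing_open[where f = ?E])
    show "\<exists>y. (?E has_real_derivative y) (at s) \<and> y \<le> 0" if "0 < s" "s < t" for s
    proof -
      have "(?E has_real_derivative exp (- c * s) * (n s - c * Y s)) (at s)"
        using dE[of s] that \<open>t \<in> {0..T}\<close> by (simp add: at_within_Icc_at)
      moreover have "exp (- c * s) * (n s - c * Y s) \<le> 0"
        using le[of s] that \<open>t \<in> {0..T}\<close> by (simp add: Y_def mult_le_0_iff)
      ultimately show ?thesis by blast
    qed
    show "continuous_on {0..t} ?E"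
      by (rule continuous_on_subset[of "{0..T}"], rule DERIV_continuous_on, rule dE)
        (use \<open>t \<in> {0..T}\<close> in auto)
  qed (use \<open>t \<in> {0..T}\<close> in auto)
  then have "Y t \<le> 0" by (simp add: Y_def mult_le_0_iff)
  then have "c * Y t \<le> 0" using \<open>0 \<le> c\<close> by (simp add: mult_nonneg_nonpos)
  then show ?thesis using le[OF \<open>t \<in> {0..T}\<close>] nonneg[OF \<open>t \<in> {0..T}\<close>] by (simp add: Y_def)
qed

text \<open>
  The Dirichlet form enters through its integral over the triangle \<open>t \<le> r \<le> s\<close>, which is half of
  that over the square \<open>[0, s]\<^sup>2\<close>, hence nonnegative.
\<close>

lemma damped_wave_zero:
  fixes X Y :: "('x \<Rightarrow> real) set"
  assumes XB: "semi_inner_space X B" and YA: "semi_inner_space Y A" and YX: "Y \<subseteq> X"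
    and wX: "w \<in> C_in {0..T} X (semi_inner_space.N B)"
    and wY: "w \<in> C_in {0..T} Y (semi_inner_space.N A)"
    and wt: "wt \<in> C_in {0..T} X (semi_inner_space.N B)"
    and f: "f \<in> C_in {0..T} X (semi_inner_space.N B)"
    and deriv: "has_derivative_in {0..T} (semi_inner_space.N B) w wt"
    and weak: "\<And>\<phi> t. \<phi> \<in> Y \<Longrightarrow> 0 < t \<Longrightarrow> t < T \<Longrightarrow>
      ((\<lambda>s. B (wt s) \<phi>) has_real_derivative - \<nu> * B (wt t) \<phi> - \<kappa> * A (w t) \<phi> + B (f t) \<phi>) (at t)"
    and init: "semi_inner_space.N B (w 0) = 0" "semi_inner_space.N B (wt 0) = 0"
    and lip: "\<And>t. t \<in> {0..T} \<Longrightarrow> semi_inner_space.N B (f t) \<le> L * semi_inner_space.N B (w t)"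
    and pos: "0 \<le> \<nu>" "0 \<le> \<kappa>" "0 \<le> L" and "t \<in> {0..T}"
  shows "semi_inner_space.N B (w t) = 0"
proof -
  interpret X: semi_inner_space X B by (rule XB)
  interpret Y: semi_inner_space Y A by (rule YA)
  define n where "n = (\<lambda>t. X.N (w t))"
  define I where "I = (\<lambda>t. integral {0..t} n)"
  define g where "g = (\<lambda>r. integral {0..r} (\<lambda>t. A (w t) (w r)))"
  define G where "G = (\<lambda>r. integral {0..r} g)"
  have memX: "w t \<in> X" "wt t \<in> X" "f t \<in> X" and memY: "w t \<in> Y" if "t \<in> {0..T}" for t
    using that X.C_in_mem[OF wX] X.C_in_mem[OF wt] X.C_in_mem[OF f] Y.C_in_mem[OF wY] by auto
  have cn: "continuous_on {0..T} n"
    unfolding n_def using X.continuous_on_N[OF wX] .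
  have n0: "0 \<le> n t" if "t \<in> {0..T}" for t
    using X.N_nonneg memX that by (simp add: n_def)
  have cA: "continuous_on ({0..T} \<times> {0..T}) (\<lambda>(t, r). A (w t) (w r))"
    by (rule Y.continuous_on_B[OF wY wY])
  have cg: "continuous_on {0..T} g"
    unfolding g_def by (rule continuous_on_triangle_integral[OF cA])
  have G0: "0 \<le> G r" if "r \<in> {0..T}" for r
    unfolding G_def g_def
  proof (rule psd_kernel_triangle_integral_nonneg)
    show "continuous_on ({0..r} \<times> {0..r}) (\<lambda>(t, r). A (w t) (w r))"
      using that by (intro continuous_on_subset[OF cA]) auto
    show "0 \<le> (\<Sum>i<n. \<Sum>j<n. A (w (x j)) (w (x i)))" if x: "\<And>i. i < n \<Longrightarrow> x i \<in> {0..r}" for n :: nat and x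
    proof (rule Y.gram_nonneg)
      show "w (x i) \<in> Y" if "i < n" for i
        using x[OF that] \<open>r \<in> {0..T}\<close> by (intro memY) auto
    qed
  qed (use that Y.sym in auto)
  \<comment> \<open>The equation is tested at each time s with the fixed element \<open>w r\<close>
    and integrated over 0 < s < r. The damping term is itself a derivative and is absorbed into the
    primitive \<open>?P\<close>. The equation is given only at interior times; continuity of
    \<open>?P\<close> on the closed interval closes the gap.\<close>
  have tested: "B (wt r) (w r) + \<nu> * (n r)\<^sup>2 + \<kappa> * g r \<le> L * (I r * n r)" if r: "r \<in> {0..T}" for r
  proof -
    have sub: "{0..r} \<subseteq> {0..T}" using r by auto
    have cwr: "(\<lambda>t. w r) \<in> C_in {0..T} X X.N"
      using memX(1)[OF r] by (rule X.const_in_C_in)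
    let ?P = "\<lambda>s. B (wt s) (w r) + \<nu> * B (w s) (w r)"
    have "((\<lambda>s. - \<kappa> * A (w s) (w r) + B (f s) (w r)) has_integral ?P r - ?P 0) {0..r}"
    proof (rule fundamental_theorem_of_calculus_interior)
      show "continuous_on {0..r} ?P"
        by (intro continuous_intros continuous_on_subset[OF X.continuous_on_B_diag sub] wt wX cwr)
      show "(?P has_vector_derivative - \<kappa> * A (w s) (w r) + B (f s) (w r)) (at s)" if "s \<in> {0<..<r}" for s
      proof -
        have s: "0 < s" "s < T" "s \<in> {0..T}" using that r by auto
        have "((\<lambda>s. B (w s) (w r)) has_real_derivative B (wt s) (w r)) (at s within {0..T})"
          by (rule X.has_real_derivative_B) (use memX r s deriv in auto)
        then have "((\<lambda>s. B (w s) (w r)) has_real_derivative B (wt s) (w r)) (at s)"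
          using s by (simp add: at_within_Icc_at)
        then have "(?P has_real_derivative - \<kappa> * A (w s) (w r) + B (f s) (w r)) (at s)"
          using weak[OF memY[OF r] s(1,2)] by (auto intro!: derivative_eq_intros)
        then show ?thesis by (simp add: has_real_derivative_iff_has_vector_derivative)
      qed
    qed (use r in auto)
    \<comment> \<open>The initial data vanish only in the seminorm; Cauchy-Schwarz turns this into
      vanishing pairings.\<close>
    moreover have "B (wt 0) (w r) = 0" "B (w 0) (w r) = 0"
      using X.Cauchy_Schwarz[of "wt 0" "w r"] X.Cauchy_Schwarz[of "w 0" "w r"] init memX r by simp_all
    then have "?P 0 = 0" by simp
    moreover have iA: "(\<lambda>t. A (w t) (w r)) integrable_on {0..r}"
      using continuous_on_section[OF cA r sub] by (rule integrable_continuous_real)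
    moreover have iF: "(\<lambda>t. B (f t) (w r)) integrable_on {0..r}"
      by (intro integrable_continuous_real continuous_on_subset[OF X.continuous_on_B_diag sub] f cwr)
    ultimately have "?P r = - \<kappa> * g r + integral {0..r} (\<lambda>t. B (f t) (w r))"
      using integral_unique[OF has_integral_add[OF has_integral_mult_right[OF integrable_integral[OF iA], of "- \<kappa>"]
            integrable_integral[OF iF]]]
      by (auto simp: g_def dest!: integral_unique)
    moreover have "integral {0..r} (\<lambda>t. B (f t) (w r)) \<le> integral {0..r} (\<lambda>t. L * n r * n t)"
    proof (rule integral_le[OF iF])
      show "(\<lambda>t. L * n r * n t) integrable_on {0..r}"
        by (intro integrable_continuous_real continuous_intros continuous_on_subset[OF cn sub])
      show "B (f t) (w r) \<le> L * n r * n t" if "t \<in> {0..r}" for t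
      proof -
        have t: "t \<in> {0..T}" using that sub by auto
        have "B (f t) (w r) \<le> X.N (f t) * n r"
          using X.Cauchy_Schwarz[of "f t" "w r"] memX t r by (simp add: n_def abs_le_iff)
        also have "\<dots> \<le> L * n t * n r"
          using lip[OF t] n0[OF r] by (intro mult_right_mono) (auto simp: n_def)
        finally show ?thesis by (simp add: mult_ac)
      qed
    qed
    ultimately show ?thesis
      using X.N_square[OF memX(1)[OF r]] by (simp add: I_def n_def algebra_simps)
  qed
  \<comment> \<open>This is the quantity whose derivative \<open>tested\<close> bounds by - \<nu> (n
    r)^2. Since it starts at 0 it stays nonpositive.\<close>
  define E where "E = (\<lambda>r. B (w r) (w r) / 2 + \<kappa> * G r - L / 2 * (I r)\<^sup>2)"
  have dE: "(E has_real_derivative B (wt r) (w r) + \<kappa> * g r - L * (I r * n r)) (at r within {0..T})"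
    if r: "r \<in> {0..T}" for r
  proof -
    have "((\<lambda>r. B (w r) (w r)) has_real_derivative 2 * B (wt r) (w r)) (at r within {0..T})"
      by (rule X.has_real_derivative_B_self) (use wX memX deriv r in auto)
    moreover have "(I has_real_derivative n r) (at r within {0..T})"
      unfolding I_def by (rule integral_has_real_derivative[OF cn r])
    moreover have "(G has_real_derivative g r) (at r within {0..T})"
      unfolding G_def by (rule integral_has_real_derivative[OF cg r])
    ultimately show ?thesis
      unfolding E_def by (auto intro!: derivative_eq_intros)
  qed
  have E0: "E r \<le> 0" if r: "r \<in> {0..T}" for r
  proof -
    have "E r \<le> E 0"
    proof (rule DERIV_nonpos_imp_decreasing_open[where f = E])
      show "\<exists>y. (E has_real_derivative y) (at s) \<and> y \<le> 0" if "0 < s" "s < r" for s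
      proof -
        have s: "s \<in> {0..T}" "s \<in> {0<..<T}" using that r by auto
        have "(E has_real_derivative B (wt s) (w s) + \<kappa> * g s - L * (I s * n s)) (at s)"
          using dE[OF s(1)] s(2) by (simp add: at_within_Icc_at)
        moreover have "0 \<le> \<nu> * (n s)\<^sup>2" using \<open>0 \<le> \<nu>\<close> by simp
        then have "B (wt s) (w s) + \<kappa> * g s - L * (I s * n s) \<le> 0"
          using tested[OF s(1)] by linarith
        ultimately show ?thesis by blast
      qed
      show "continuous_on {0..r} E"
        by (rule continuous_on_subset[of "{0..T}"], rule DERIV_continuous_on, rule dE) (use r in auto)
    qed (use r in auto)
    moreover have "0 \<in> {0..T}" using r by auto
    then have "E 0 = 0"
      using init(1) X.N_square[OF memX(1), of 0] by (simp add: E_def G_def I_def)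
    ultimately show ?thesis by simp
  qed
  \<comment> \<open>Discarding the nonnegative \<open>\<kappa> * G r\<close> leaves (n r)^2 \<le> L
    (I r)^2, whose square root is a linear Gronwall inequality.\<close>
  have bound: "n r \<le> sqrt L * I r" if r: "r \<in> {0..T}" for r
  proof (rule power2_le_imp_le)
    have "0 \<le> \<kappa> * G r" using pos G0[OF r] by simp
    then have "B (w r) (w r) \<le> L * (I r)\<^sup>2"
      using E0[OF r] unfolding E_def by linarith
    then show "(n r)\<^sup>2 \<le> (sqrt L * I r)\<^sup>2"
      using X.N_square[OF memX(1)[OF r]] pos by (simp add: n_def power_mult_distrib)
    have "0 \<le> I r"
      unfolding I_def using n0 r by (intro integral_nonneg integrable_continuous_real continuous_on_subset[OF cn]) auto
    then show "0 \<le> sqrt L * I r" using pos by simp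
  qed
  have "n t = 0"
    by (rule Gronwall_zero[OF cn, where c = "sqrt L"]) (use bound n0 pos \<open>t \<in> {0..T}\<close> in \<open>auto simp: I_def\<close>)
  then show ?thesis by (simp add: n_def)
qed

section \<open>The space of square integrable functions\<close>

lemma L2_measurable: "f \<in> L2 \<Omega> \<Longrightarrow> f \<in> borel_measurable (lebesgue_on \<Omega>)"
  and L2_integrable_square: "f \<in> L2 \<Omega> \<Longrightarrow> integrable (lebesgue_on \<Omega>) (\<lambda>x. (norm (f x))\<^sup>2)"
  by (auto simp: L2_def)

lemma L2_add:
  assumes f: "f \<in> L2 \<Omega>" and g: "g \<in> L2 \<Omega>"
  shows "(\<lambda>x. f x + g x) \<in> L2 \<Omega>"
  unfolding L2_def
proof (intro CollectI conjI)
  note [measurable] = L2_measurable[OF f] L2_measurable[OF g]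
  show "(\<lambda>x. f x + g x) \<in> borel_measurable (lebesgue_on \<Omega>)" by measurable
  show "integrable (lebesgue_on \<Omega>) (\<lambda>x. (norm (f x + g x))\<^sup>2)"
  proof (rule Bochner_Integration.integrable_bound)
    show "integrable (lebesgue_on \<Omega>) (\<lambda>x. 2 * (norm (f x))\<^sup>2 + 2 * (norm (g x))\<^sup>2)"
      using f g by (auto simp: L2_def)
    have "(norm (f x + g x))\<^sup>2 \<le> 2 * (norm (f x))\<^sup>2 + 2 * (norm (g x))\<^sup>2" for x
      using power_mono[OF norm_triangle_ineq[of "f x" "g x"], of 2]
        sum_squares_bound[of "norm (f x)" "norm (g x)"] by (simp add: power2_sum)
    then show "AE x in lebesgue_on \<Omega>. norm ((norm (f x + g x))\<^sup>2) \<le> norm (2 * (norm (f x))\<^sup>2 + 2 * (norm (g x))\<^sup>2)"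
      by simp
  qed measurable
qed

lemma L2_scaleR:
  assumes f: "f \<in> L2 \<Omega>"
  shows "(\<lambda>x. c *\<^sub>R f x) \<in> L2 \<Omega>"
proof -
  note [measurable] = L2_measurable[OF f]
  show ?thesis using L2_integrable_square[OF f] by (simp add: L2_def power_mult_distrib)
qed

lemma L2_diff: "f \<in> L2 \<Omega> \<Longrightarrow> g \<in> L2 \<Omega> \<Longrightarrow> (\<lambda>x. f x - g x) \<in> L2 \<Omega>"
  using L2_add[of f \<Omega> "\<lambda>x. (-1) *\<^sub>R g x"] L2_scaleR[of g \<Omega> "-1"] by simp

lemma L2_zero: "(\<lambda>x. 0) \<in> L2 \<Omega>"
  by (simp add: L2_def)

lemma L2_inner_integrable:
  assumes f: "f \<in> L2 \<Omega>" and g: "g \<in> L2 \<Omega>"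
  shows "integrable (lebesgue_on \<Omega>) (\<lambda>x. f x \<bullet> g x)"
proof (rule Bochner_Integration.integrable_bound)
  note [measurable] = L2_measurable[OF f] L2_measurable[OF g]
  show "(\<lambda>x. f x \<bullet> g x) \<in> borel_measurable (lebesgue_on \<Omega>)" by measurable
  show "integrable (lebesgue_on \<Omega>) (\<lambda>x. (norm (f x))\<^sup>2 + (norm (g x))\<^sup>2)"
    using f g by (auto simp: L2_def)
  have "\<bar>f x \<bullet> g x\<bar> \<le> (norm (f x))\<^sup>2 + (norm (g x))\<^sup>2" for x
    using Cauchy_Schwarz_ineq2[of "f x" "g x"] sum_squares_bound[of "norm (f x)" "norm (g x)"]
      mult_nonneg_nonneg[of "norm (f x)" "norm (g x)"]
    by simp
  then show "AE x in lebesgue_on \<Omega>. norm (f x \<bullet> g x) \<le> norm ((norm (f x))\<^sup>2 + (norm (g x))\<^sup>2)"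
    by simp
qed

lemma L2_inner_add:
  "f \<in> L2 \<Omega> \<Longrightarrow> g \<in> L2 \<Omega> \<Longrightarrow> h \<in> L2 \<Omega> \<Longrightarrow>
    L2_inner \<Omega> (\<lambda>x. f x + g x) h = L2_inner \<Omega> f h + L2_inner \<Omega> g h"
  by (simp add: L2_inner_def inner_add_left L2_inner_integrable)

lemma L2_inner_scaleR: "L2_inner \<Omega> (\<lambda>x. c *\<^sub>R f x) h = c * L2_inner \<Omega> f h"
  by (simp add: L2_inner_def)

lemma L2_inner_commute: "L2_inner \<Omega> f g = L2_inner \<Omega> g f"
  by (simp add: L2_inner_def inner_commute)

lemma L2_inner_self_nonneg: "0 \<le> L2_inner \<Omega> f f"
  by (simp add: L2_inner_def)

lemma L2_inner_cong_ae:
  assumes "f \<in> L2 \<Omega>" "f' \<in> L2 \<Omega>" "g \<in> L2 \<Omega>" "ae_eq \<Omega> f f'"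
  shows "L2_inner \<Omega> f g = L2_inner \<Omega> f' g"
proof -
  note [measurable] = assms(1-3)[THEN L2_measurable]
  show ?thesis
    using assms(4) unfolding L2_inner_def ae_eq_def by (intro integral_cong_AE) auto
qed

lemma L2_norm_eq_0_iff:
  assumes "f \<in> L2 \<Omega>"
  shows "L2_norm \<Omega> f = 0 \<longleftrightarrow> ae_eq \<Omega> f (\<lambda>x. 0)"
  using integral_nonneg_eq_0_iff_AE[OF L2_integrable_square[OF assms]]
  by (simp add: L2_norm_def L2_inner_def ae_eq_def power2_norm_eq_inner)

lemma L2_norm_diff_eq_0_iff:
  "f \<in> L2 \<Omega> \<Longrightarrow> g \<in> L2 \<Omega> \<Longrightarrow> L2_norm \<Omega> (\<lambda>x. f x - g x) = 0 \<longleftrightarrow> ae_eq \<Omega> f g"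
  using L2_norm_eq_0_iff[OF L2_diff] by (simp add: ae_eq_def)

lemma ae_eq_sym: "ae_eq \<Omega> f g \<Longrightarrow> ae_eq \<Omega> g f"
  unfolding ae_eq_def by (auto elim: eventually_mono)

lemma ae_eq_trans: "ae_eq \<Omega> f g \<Longrightarrow> ae_eq \<Omega> g h \<Longrightarrow> ae_eq \<Omega> f h"
  unfolding ae_eq_def by (auto elim: eventually_elim2)

lemma semi_inner_space_L2: "semi_inner_space (L2 \<Omega>) (L2_inner \<Omega>)"
  using L2_scaleR[where ?'b = real] L2_inner_scaleR[where ?'b = real]
  by unfold_locales (auto intro: L2_zero L2_add L2_inner_add L2_inner_commute L2_inner_self_nonneg)

interpretation L2: semi_inner_space "L2 \<Omega>" "L2_inner \<Omega>"
  rewrites "semi_inner_space.N (L2_inner \<Omega>) = L2_norm \<Omega>"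
proof -
  interpret semi_inner_space "L2 \<Omega>" "L2_inner \<Omega>" by (rule semi_inner_space_L2)
  show "semi_inner_space (L2 \<Omega>) (L2_inner \<Omega>)" by unfold_locales
  show "N = L2_norm \<Omega>" by (auto simp: fun_eq_iff N_def L2_norm_def)
qed

section \<open>Smooth bump functions\<close>

lemma Ck_0_iff: "Ck 0 f \<longleftrightarrow> continuous_on UNIV f" by simp

lemma Ck_SucE:
  assumes "Ck (Suc k) f"
  obtains g where "\<And>x. (f has_derivative (\<lambda>h. g x \<bullet> h)) (at x)" "\<And>b. b \<in> Basis \<Longrightarrow> Ck k (\<lambda>x. g x \<bullet> b)"
  using assms by auto

lemma Ck_SucI:
  assumes "\<And>x. (f has_derivative (\<lambda>h. g x \<bullet> h)) (at x)" "\<And>b. b \<in> Basis \<Longrightarrow> Ck k (\<lambda>x. g x \<bullet> b)"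
  shows "Ck (Suc k) f"
  using assms by auto

declare Ck.simps [simp del]

lemma Ck_const: "Ck k (\<lambda>x. c)"
proof (induction k arbitrary: c)
  case (Suc k)
  show ?case by (rule Ck_SucI[where g = "\<lambda>x. 0"]) (auto intro: Suc)
qed (simp add: Ck.simps)

text \<open>The product rule needs this: the gradient of a product contains the undifferentiated
  factors, which must also count as one order less smooth.\<close>

lemma Ck_SucD: "Ck (Suc k) f \<Longrightarrow> Ck k f"
proof (induction k arbitrary: f)
  case 0
  then show ?case
    by (auto simp: Ck_0_iff elim!: Ck_SucE intro!: continuous_at_imp_continuous_on has_derivative_continuous)
next
  case (Suc k)
  from Suc.prems obtain g where "\<And>x. (f has_derivative (\<lambda>h. g x \<bullet> h)) (at x)"
    "\<And>b. b \<in> Basis \<Longrightarrow> Ck (Suc k) (\<lambda>x. g x \<bullet> b)" by (rule Ck_SucE) blast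
  then show ?case by (intro Ck_SucI[where g = g]) (auto intro: Suc.IH)
qed

lemma Ck_add: "Ck k f \<Longrightarrow> Ck k g \<Longrightarrow> Ck k (\<lambda>x. f x + g x)"
proof (induction k arbitrary: f g)
  case 0
  then show ?case by (simp add: Ck_0_iff continuous_on_add)
next
  case (Suc k)
  obtain f' where f': "\<And>x. (f has_derivative (\<lambda>h. f' x \<bullet> h)) (at x)"
    "\<And>b. b \<in> Basis \<Longrightarrow> Ck k (\<lambda>x. f' x \<bullet> b)" using Suc.prems(1) by (rule Ck_SucE) blast
  obtain g' where g': "\<And>x. (g has_derivative (\<lambda>h. g' x \<bullet> h)) (at x)"
    "\<And>b. b \<in> Basis \<Longrightarrow> Ck k (\<lambda>x. g' x \<bullet> b)" using Suc.prems(2) by (rule Ck_SucE) blast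
  show ?case
  proof (rule Ck_SucI)
    show "((\<lambda>x. f x + g x) has_derivative (\<lambda>h. (f' x + g' x) \<bullet> h)) (at x)" for x
      unfolding inner_add_left by (intro has_derivative_add f' g')
    show "Ck k (\<lambda>x. (f' x + g' x) \<bullet> b)" if "b \<in> Basis" for b
      unfolding inner_add_left using f'(2) g'(2) that by (intro Suc.IH) auto
  qed
qed

lemma Ck_mult: "Ck k f \<Longrightarrow> Ck k g \<Longrightarrow> Ck k (\<lambda>x. f x * g x)"
proof (induction k arbitrary: f g)
  case 0
  then show ?case by (simp add: Ck_0_iff continuous_on_mult)
next
  case (Suc k)
  obtain f' where f': "\<And>x. (f has_derivative (\<lambda>h. f' x \<bullet> h)) (at x)"
    "\<And>b. b \<in> Basis \<Longrightarrow> Ck k (\<lambda>x. f' x \<bullet> b)" using Suc.prems(1) by (rule Ck_SucE) blast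
  obtain g' where g': "\<And>x. (g has_derivative (\<lambda>h. g' x \<bullet> h)) (at x)"
    "\<And>b. b \<in> Basis \<Longrightarrow> Ck k (\<lambda>x. g' x \<bullet> b)" using Suc.prems(2) by (rule Ck_SucE) blast
  show ?case
  proof (rule Ck_SucI)
    show "((\<lambda>x. f x * g x) has_derivative (\<lambda>h. (f x *\<^sub>R g' x + g x *\<^sub>R f' x) \<bullet> h)) (at x)" for x
      by (rule derivative_eq_intros f' g' refl)+ (auto simp: inner_add_left algebra_simps)
    show "Ck k (\<lambda>x. (f x *\<^sub>R g' x + g x *\<^sub>R f' x) \<bullet> b)" if "b \<in> Basis" for b
      unfolding inner_add_left inner_scaleR_left
      using f'(2) g'(2) that Ck_SucD[OF Suc.prems(1)] Ck_SucD[OF Suc.prems(2)]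
      by (intro Ck_add Suc.IH) auto
  qed
qed

lemma Ck_prod: "finite I \<Longrightarrow> (\<And>i. i \<in> I \<Longrightarrow> Ck k (f i)) \<Longrightarrow> Ck k (\<lambda>x. \<Prod>i\<in>I. f i x)"
  by (induction I rule: finite_induct) (auto intro: Ck_const Ck_mult)

text \<open>A class \<open>D\<close> closed under differentiation consists of smooth functions. For
  a composition with an affine functional the gradient is again such a composition times the
  constant vector \<open>a\<close>, so no chain rule for higher derivatives is needed.\<close>

lemma Ck_ridge:
  fixes D :: "(real \<Rightarrow> real) set"
  assumes D: "\<And>f. f \<in> D \<Longrightarrow> \<exists>f'\<in>D. \<forall>t. (f has_real_derivative f' t) (at t)"
  shows "f \<in> D \<Longrightarrow> Ck k (\<lambda>x. f (a \<bullet> x + c))"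
proof (induction k arbitrary: f)
  case 0
  then have "continuous_on UNIV f"
    using D[of f] DERIV_isCont continuous_at_imp_continuous_on by blast
  then show ?case
    unfolding Ck_0_iff by (rule continuous_on_compose2) (auto intro!: continuous_intros)
next
  case (Suc k)
  obtain f' where f': "f' \<in> D" "\<And>t. (f has_real_derivative f' t) (at t)"
    using D[OF Suc.prems] by blast
  show ?case
  proof (rule Ck_SucI)
    show "((\<lambda>x. f (a \<bullet> x + c)) has_derivative (\<lambda>h. (f' (a \<bullet> x + c) *\<^sub>R a) \<bullet> h)) (at x)" for x
    proof -
      have "((\<lambda>x. a \<bullet> x + c) has_derivative (\<lambda>h. a \<bullet> h)) (at x)"
        by (auto intro!: derivative_eq_intros)
      from has_derivative_compose[OF this f'(2)[of "a \<bullet> x + c", unfolded has_field_derivative_def]]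
      show ?thesis by simp
    qed
    show "Ck k (\<lambda>x. (f' (a \<bullet> x + c) *\<^sub>R a) \<bullet> b)" for b
      unfolding inner_scaleR_left by (intro Ck_mult Ck_const Suc.IH f'(1))
  qed
qed

definition poly_exp_inverse :: "real poly \<Rightarrow> real \<Rightarrow> real" where
  "poly_exp_inverse p t = (if t > 0 then poly p (1 / t) * exp (- (1 / t)) else 0)"

lemma poly_times_exp_minus_tendsto_0: "((\<lambda>t. poly p t * exp (- t)) \<longlongrightarrow> (0::real)) at_top"
proof -
  have "((\<lambda>t. \<Sum>i\<le>degree p. coeff p i * (t ^ i / exp t)) \<longlongrightarrow> (\<Sum>i\<le>degree p. coeff p i * 0)) at_top"
    by (intro tendsto_sum tendsto_mult tendsto_const tendsto_power_div_exp_0)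
  then show ?thesis
    by (simp add: poly_altdef sum_distrib_right exp_minus divide_inverse mult.assoc)
qed

lemma poly_exp_inverse_tendsto_0: "(poly_exp_inverse p \<longlongrightarrow> 0) (at 0)"
proof -
  have "((\<lambda>t. poly p (inverse t) * exp (- inverse t)) \<longlongrightarrow> 0) (at_right 0)"
    by (rule filterlim_compose[OF poly_times_exp_minus_tendsto_0 filterlim_inverse_at_top_right])
  then have "(poly_exp_inverse p \<longlongrightarrow> 0) (at_right 0)"
    by (rule Lim_transform_eventually)
      (auto simp: eventually_at_filter poly_exp_inverse_def inverse_eq_divide)
  moreover have "(poly_exp_inverse p \<longlongrightarrow> 0) (at_left 0)"
    by (rule Lim_transform_eventually[OF tendsto_const])
      (auto simp: eventually_at_filter poly_exp_inverse_def)
  ultimately show ?thesis by (simp add: filterlim_split_at)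
qed

text \<open>In the variable s = 1 / t one has d/dt = - s^2 d/ds, and the s-derivative of p(s) exp (-
  s) is (p' - p)(s) exp (- s). This explains the polynomial s^2 (p - p').\<close>

lemma poly_exp_inverse_has_derivative:
  "(poly_exp_inverse p has_real_derivative poly_exp_inverse ([:0, 0, 1:] * (p - pderiv p)) t) (at t)"
proof -
  consider "t > 0" | "t < 0" | "t = 0" by linarith
  then show ?thesis
  proof cases
    case 1
    have "((\<lambda>t. poly p (1 / t) * exp (- (1 / t))) has_real_derivative
        poly_exp_inverse ([:0, 0, 1:] * (p - pderiv p)) t) (at t)"
      using 1 unfolding poly_exp_inverse_def
      by (auto intro!: derivative_eq_intros DERIV_chain2[OF poly_DERIV] simp: field_simps power2_eq_square)
    then show ?thesis
      by (rule DERIV_cong_ev[OF refl _ refl, THEN iffD1, rotated])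
        (use 1 in \<open>auto simp: poly_exp_inverse_def intro!: eventually_mono[OF eventually_nhds_in_open[of "{0<..}"]]\<close>)
  next
    case 2
    have "((\<lambda>t. 0) has_real_derivative poly_exp_inverse ([:0, 0, 1:] * (p - pderiv p)) t) (at t)"
      using 2 by (simp add: poly_exp_inverse_def)
    then show ?thesis
      by (rule DERIV_cong_ev[OF refl _ refl, THEN iffD1, rotated])
        (use 2 in \<open>auto simp: poly_exp_inverse_def intro!: eventually_mono[OF eventually_nhds_in_open[of "{..<0}"]]\<close>)
  next
    case 3
    \<comment> \<open>Dividing by s multiplies the polynomial by its variable. At s = 0 both sides
      are 0, the left one by the convention for division by zero.\<close>
    have "(\<lambda>s. (poly_exp_inverse p s - poly_exp_inverse p 0) / (s - 0)) = poly_exp_inverse (pCons 0 p)"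
      by (auto simp: fun_eq_iff poly_exp_inverse_def)
    then show ?thesis
      using poly_exp_inverse_tendsto_0[of "pCons 0 p"] 3
      by (simp add: has_field_derivative_iff poly_exp_inverse_def)
  qed
qed

lemma Ck_poly_exp_inverse: "Ck k (\<lambda>x. poly_exp_inverse p (a \<bullet> x + c))"
  using poly_exp_inverse_has_derivative
  by (intro Ck_ridge[where D = "range poly_exp_inverse"]) blast+

lemma poly_exp_inverse_1_bounds: "0 \<le> poly_exp_inverse 1 t" "poly_exp_inverse 1 t \<le> 1"
  by (auto simp: poly_exp_inverse_def)

lemma poly_exp_inverse_1_tendsto_indicator:
  "(\<lambda>n. poly_exp_inverse 1 (real n * t)) \<longlonglongrightarrow> (if t > 0 then 1 else 0)"
proof (cases "t > 0")
  case True
  \<comment> \<open>The scale factor 0 gives argument 0, where the exponential formula does not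
    apply; the first term of the sequence is dropped for this reason.\<close>
  have "(\<lambda>n. exp (- (1 / t) * inverse (real (Suc n)))) \<longlonglongrightarrow> exp (- (1 / t) * 0)"
    by (intro tendsto_intros LIMSEQ_inverse_real_of_nat)
  then have "(\<lambda>n. poly_exp_inverse 1 (real (Suc n) * t)) \<longlonglongrightarrow> 1"
    using True by (simp add: poly_exp_inverse_def field_simps del: of_nat_Suc)
  then show ?thesis using True by (subst (asm) filterlim_sequentially_Suc) simp
next
  case False
  then have "\<not> real n * t > 0" for n by (simp add: zero_less_mult_iff)
  then show ?thesis using False by (simp add: poly_exp_inverse_def)
qed

text \<open>
  Since \<open>exp (- 1 / t)\<close> to the power \<open>1 / n\<close> is its own rescaling \<open>exp (- 1 / (n t))\<close>, these bump
  functions are smooth and tend to the indicator of the box.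
\<close>

definition box_bump :: "'a::euclidean_space \<Rightarrow> 'a \<Rightarrow> nat \<Rightarrow> 'a \<Rightarrow> real" where
  "box_bump a b n x = (\<Prod>i\<in>Basis. poly_exp_inverse 1 (real n * ((x - a) \<bullet> i)) *
      poly_exp_inverse 1 (real n * ((b - x) \<bullet> i)))"

lemma box_bump_bounds: "0 \<le> box_bump a b n x" "box_bump a b n x \<le> 1"
  unfolding box_bump_def
  by (auto intro!: prod_nonneg prod_le_1 mult_nonneg_nonneg mult_le_one poly_exp_inverse_1_bounds)

lemma box_bump_tendsto_indicator: "(\<lambda>n. box_bump a b n x) \<longlonglongrightarrow> indicator (box a b) x"
proof -
  have "(\<lambda>n. box_bump a b n x) \<longlonglongrightarrow>
      (\<Prod>i\<in>Basis. (if (x - a) \<bullet> i > 0 then 1 else 0) * (if (b - x) \<bullet> i > 0 then 1 else 0))"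
    unfolding box_bump_def by (intro tendsto_prod tendsto_mult poly_exp_inverse_1_tendsto_indicator)
  also have "(\<Prod>i\<in>Basis. (if (x - a) \<bullet> i > 0 then 1 else 0) * (if (b - x) \<bullet> i > 0 then 1 else 0))
      = (indicator (box a b) x :: real)"
    by (auto simp: indicator_def box_def inner_diff_left intro!: prod.neutral)
  finally show ?thesis .
qed

lemma box_bump_test_function:
  assumes "cbox a b \<subseteq> \<Omega>"
  shows "box_bump a b n \<in> test_functions \<Omega>"
proof -
  have "x \<in> box a b" if "box_bump a b n x \<noteq> 0" for x
    using that
    by (auto simp: box_bump_def poly_exp_inverse_def box_def inner_diff_left zero_less_mult_iff split: if_splits)
  then have "closure {x. box_bump a b n x \<noteq> 0} \<subseteq> cbox a b"
    by (intro closure_minimal) (use box_subset_cbox in auto)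
  moreover have "Ck k (box_bump a b n)" for k
  proof -
    have "Ck k (\<lambda>x. poly_exp_inverse 1 (real n * ((x - a) \<bullet> i)) *
        poly_exp_inverse 1 (real n * ((b - x) \<bullet> i)))" for i
    proof -
      have "Ck k (\<lambda>x. poly_exp_inverse 1 ((real n *\<^sub>R i) \<bullet> x + - real n * (a \<bullet> i)) *
          poly_exp_inverse 1 ((- real n *\<^sub>R i) \<bullet> x + real n * (b \<bullet> i)))"
        by (intro Ck_mult Ck_poly_exp_inverse)
      then show ?thesis
        by (simp add: inner_diff_left inner_commute[of i] right_diff_distrib)
    qed
    then show ?thesis unfolding box_bump_def by (intro Ck_prod) auto
  qed
  moreover from calculation(1) have "compact (closure {x. box_bump a b n x \<noteq> 0})"
    using bounded_subset[OF bounded_cbox] by (simp only: compact_eq_bounded_closed closed_closure simp_thms)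
  ultimately show ?thesis
    using assms unfolding test_functions_def by (simp add: order_trans)
qed

section \<open>Test functions are weakly differentiable\<close>

lemma test_function_grad:
  fixes \<phi> :: "'a::euclidean_space \<Rightarrow> real"
  assumes "\<phi> \<in> test_functions \<Omega>"
  obtains G K where "\<And>x. (\<phi> has_derivative (\<lambda>h. G x \<bullet> h)) (at x)" "continuous_on UNIV G"
    "compact K" "K \<subseteq> \<Omega>" "\<And>x. x \<notin> K \<Longrightarrow> \<phi> x = 0" "\<And>x. x \<notin> K \<Longrightarrow> G x = 0"
proof -
  have "Ck (Suc 0) \<phi>" using assms by (simp add: test_functions_def)
  then obtain G where G: "\<And>x. (\<phi> has_derivative (\<lambda>h. G x \<bullet> h)) (at x)"
    "\<And>b. b \<in> Basis \<Longrightarrow> Ck 0 (\<lambda>x. G x \<bullet> b)" by (rule Ck_SucE) blast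
  have "continuous_on UNIV G"
    using G(2) by (subst continuous_on_componentwise) (simp add: Ck_0_iff)
  moreover define K where "K = closure {x. \<phi> x \<noteq> 0}"
  have K: "compact K" "K \<subseteq> \<Omega>" using assms by (simp_all add: test_functions_def K_def)
  have \<phi>0: "\<phi> x = 0" if "x \<notin> K" for x
    using that closure_subset[of "{x. \<phi> x \<noteq> 0}"] unfolding K_def by blast
  have "G x = 0" if "x \<notin> K" for x
  proof -
    have "open (- K)" using K(1) by (simp add: compact_imp_closed open_Compl)
    then have "(\<phi> has_derivative (\<lambda>h. 0)) (at x)"
      using that \<phi>0 by (intro has_derivative_transform_within_open[OF has_derivative_const[of 0]]) auto
    then have "(\<lambda>h. G x \<bullet> h) = (\<lambda>h. 0)" using G(1) has_derivative_unique by blast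
    then show ?thesis by (metis inner_eq_zero_iff)
  qed
  ultimately show ?thesis using G(1) K \<phi>0 that by blast
qed

lemma compact_support_bounded:
  fixes f :: "'a::euclidean_space \<Rightarrow> 'b::real_normed_vector"
  assumes "compact K" "continuous_on UNIV f" "\<And>x. x \<notin> K \<Longrightarrow> f x = 0"
  obtains M where "0 \<le> M" "\<And>x. norm (f x) \<le> M"
proof -
  have "bounded (f ` K)"
    using assms by (intro compact_imp_bounded compact_continuous_image) (auto intro: continuous_on_subset)
  then obtain M where M: "\<And>x. x \<in> K \<Longrightarrow> norm (f x) \<le> M" by (auto simp: bounded_iff)
  have "norm (f x) \<le> max M 0" for x
    using M[of x] assms(3)[of x] by (cases "x \<in> K") auto
  then show ?thesis using that[of "max M 0"] by simp
qed

lemma open_bounded_finite_measure: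
  "open \<Omega> \<Longrightarrow> bounded \<Omega> \<Longrightarrow> finite_measure (lebesgue_on (\<Omega> :: 'a::euclidean_space set))"
  by (intro finite_measure_lebesgue_on bounded_set_imp_lmeasurable) (auto intro: sets_completionI_sets)

lemma compact_support_L2:
  fixes f :: "'a::euclidean_space \<Rightarrow> 'b::euclidean_space"
  assumes "open \<Omega>" "bounded \<Omega>" "compact K" "continuous_on UNIV f" "\<And>x. x \<notin> K \<Longrightarrow> f x = 0"
  shows "f \<in> L2 \<Omega>"
proof -
  interpret finite_measure "lebesgue_on \<Omega>"
    using assms by (intro open_bounded_finite_measure)
  obtain M where M: "0 \<le> M" "\<And>x. norm (f x) \<le> M"
    using compact_support_bounded[OF assms(3-5)] by blast
  have [measurable]: "f \<in> borel_measurable (lebesgue_on \<Omega>)"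
    using assms(1,4) by (intro continuous_imp_measurable_on_sets_lebesgue) (auto intro: continuous_on_subset sets_completionI_sets)
  have "integrable (lebesgue_on \<Omega>) (\<lambda>x. (norm (f x))\<^sup>2)"
    using M by (intro integrable_const_bound[of _ "M\<^sup>2"]) (auto intro!: AE_I2 power_mono)
  then show ?thesis by (simp add: L2_def)
qed

lemma test_function_L2:
  assumes "open \<Omega>" "bounded \<Omega>" "\<phi> \<in> test_functions \<Omega>"
  shows "\<phi> \<in> L2 \<Omega>"
proof -
  obtain G K where G: "\<And>x. (\<phi> has_derivative (\<lambda>h. G x \<bullet> h)) (at x)"
    "compact K" "\<And>x. x \<notin> K \<Longrightarrow> \<phi> x = 0"
    using test_function_grad[OF assms(3)] by metis
  then have "continuous_on UNIV \<phi>"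
    by (auto intro!: continuous_at_imp_continuous_on has_derivative_continuous)
  then show ?thesis using assms(1,2) G(2,3) by (intro compact_support_L2)
qed

lemma L2_component:
  assumes "g \<in> L2 \<Omega>"
  shows "(\<lambda>x. g x \<bullet> b) \<in> L2 \<Omega>"
proof -
  note [measurable] = L2_measurable[OF assms]
  have "integrable (lebesgue_on \<Omega>) (\<lambda>x. (norm (g x \<bullet> b))\<^sup>2)"
  proof (rule Bochner_Integration.integrable_bound)
    show "integrable (lebesgue_on \<Omega>) (\<lambda>x. (norm (g x))\<^sup>2 * (norm b)\<^sup>2)"
      using L2_integrable_square[OF assms] by simp
    have "(norm (g x \<bullet> b))\<^sup>2 \<le> (norm (g x))\<^sup>2 * (norm b)\<^sup>2" for x
      using power_mono[OF Cauchy_Schwarz_ineq2[of "g x" b], of 2] by (simp add: power_mult_distrib)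
    then show "AE x in lebesgue_on \<Omega>. norm ((norm (g x \<bullet> b))\<^sup>2) \<le> norm ((norm (g x))\<^sup>2 * (norm b)\<^sup>2)"
      by simp
  qed measurable
  then show ?thesis by (simp add: L2_def)
qed

lemma test_function_partial_L2:
  assumes "open \<Omega>" "bounded \<Omega>" "\<phi> \<in> test_functions \<Omega>"
  shows "(\<lambda>x. frechet_derivative \<phi> (at x) b) \<in> L2 \<Omega>"
proof -
  obtain G K where G: "\<And>x. (\<phi> has_derivative (\<lambda>h. G x \<bullet> h)) (at x)" "continuous_on UNIV G"
    "compact K" "K \<subseteq> \<Omega>" "\<And>x. x \<notin> K \<Longrightarrow> \<phi> x = 0" "\<And>x. x \<notin> K \<Longrightarrow> G x = 0"
    using test_function_grad[OF assms(3)] by blast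
  have "G \<in> L2 \<Omega>"
    using assms G by (intro compact_support_L2[where K = K]) auto
  from L2_component[OF this] show ?thesis
    using frechet_derivative_at[OF G(1)] by (metis (no_types, lifting) ext)
qed

text \<open>Translation invariance replaces Fubini: the difference quotients of \<open>p\<close> in
  direction \<open>b\<close> have integral zero, and they converge dominatedly to the directional
  derivative.\<close>

lemma integral_partial_eq_0:
  fixes p :: "'a::euclidean_space \<Rightarrow> real"
  assumes deriv: "\<And>x. (p has_derivative (\<lambda>h. G x \<bullet> h)) (at x)" and cont: "continuous_on UNIV G"
    and K: "compact K" "\<And>x. x \<notin> K \<Longrightarrow> p x = 0" "\<And>x. x \<notin> K \<Longrightarrow> G x = 0"
  shows "(LINT x|lborel. G x \<bullet> b) = 0"
proof -
  have cp: "continuous_on UNIV p"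
    using deriv by (auto intro!: continuous_at_imp_continuous_on has_derivative_continuous)
  obtain M where M: "0 \<le> M" "\<And>x. norm (G x) \<le> M"
    using compact_support_bounded[OF K(1) cont K(3)] by blast
  obtain R where R: "\<And>x. x \<in> K \<Longrightarrow> norm x \<le> R"
    using compact_imp_bounded[OF K(1)] by (auto simp: bounded_iff)
  define f where "f n x = real (Suc n) * (p (x + inverse (real (Suc n)) *\<^sub>R b) - p x)" for n x
  have [measurable]: "p \<in> borel_measurable borel" "(\<lambda>x. G x \<bullet> b) \<in> borel_measurable borel"
    using cp cont by (auto intro!: borel_measurable_continuous_onI continuous_intros)
  have intp: "integrable lborel p"
  proof -
    have "integrable lborel (\<lambda>x. indicator K x *\<^sub>R p x)"
      using K(1) cp by (intro borel_integrable_compact) (auto intro: continuous_on_subset)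
    moreover have "(\<lambda>x. indicator K x *\<^sub>R p x) = p" using K(2) by (auto simp: indicator_def fun_eq_iff)
    ultimately show ?thesis by simp
  qed
  have shift: "integrable lborel (\<lambda>x. p (x + c))" "(LINT x|lborel. p (x + c)) = (LINT x|lborel. p x)" for c
  proof -
    have "integrable (distr lborel borel ((+) c)) p" using intp by (simp add: lborel_distr_plus)
    then show "integrable lborel (\<lambda>x. p (x + c))"
      by (subst (asm) integrable_distr_eq) (auto simp: add.commute)
    have "(LINT x|distr lborel borel ((+) c). p x) = (LINT x|lborel. p (c + x))"
      by (intro integral_distr) auto
    then show "(LINT x|lborel. p (x + c)) = (LINT x|lborel. p x)"
      by (simp add: lborel_distr_plus add.commute)
  qed
  have f0: "(LINT x|lborel. f n x) = 0" for n
    unfolding f_def using shift intp by simp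
  have "(\<lambda>n. LINT x|lborel. f n x) \<longlonglongrightarrow> (LINT x|lborel. G x \<bullet> b)"
  proof (rule integral_dominated_convergence)
    \<comment> \<open>All shifts are at most \<open>norm b\<close> long and \<open>K\<close> lies
      within radius \<open>R\<close>, so outside this ball every quotient vanishes; inside, the mean
      value inequality gives the height.\<close>
    show "integrable lborel (\<lambda>x. indicator (cball 0 (R + norm b)) x *\<^sub>R (M * norm b))"
      by (intro borel_integrable_compact) auto
    show "AE x in lborel. (\<lambda>n. f n x) \<longlonglongrightarrow> G x \<bullet> b"
    proof (rule AE_I2)
      fix x
      have "((\<lambda>t. p (x + t *\<^sub>R b)) has_derivative (\<lambda>t. G (x + 0 *\<^sub>R b) \<bullet> (t *\<^sub>R b))) (at 0)"
        by (rule has_derivative_compose[where g = p], (rule derivative_eq_intros refl | simp)+, use deriv[of x] in simp)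
      then have "((\<lambda>t. p (x + t *\<^sub>R b)) has_real_derivative G x \<bullet> b) (at 0)"
        by (simp add: has_field_derivative_def mult.commute[of _ "G x \<bullet> b"] fun_eq_iff)
      then have lim: "((\<lambda>t. (p (x + t *\<^sub>R b) - p x) / t) \<longlongrightarrow> G x \<bullet> b) (at 0)"
        by (simp add: has_field_derivative_iff)
      have "filterlim (\<lambda>n. inverse (real (Suc n))) (at 0) sequentially"
        using LIMSEQ_inverse_real_of_nat by (auto simp: filterlim_at)
      from filterlim_compose[OF lim this] show "(\<lambda>n. f n x) \<longlonglongrightarrow> G x \<bullet> b"
        by (simp add: f_def field_simps)
    qed
    show "AE x in lborel. norm (f n x) \<le> indicator (cball 0 (R + norm b)) x *\<^sub>R (M * norm b)" for n
    proof (rule AE_I2)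
      fix x
      let ?h = "inverse (real (Suc n)) *\<^sub>R b"
      have h: "norm ?h \<le> norm b"
        by (simp add: mult_left_le_one_le inverse_le_1_iff)
      show "norm (f n x) \<le> indicator (cball 0 (R + norm b)) x *\<^sub>R (M * norm b)"
      proof (cases "x \<in> cball 0 (R + norm b)")
        case True
        have "norm (p (x + ?h) - p x) \<le> M * norm (x + ?h - x)"
        proof (rule differentiable_bound[where S = UNIV and f' = "\<lambda>y h. G y \<bullet> h"])
          show "onorm (\<lambda>h. G y \<bullet> h) \<le> M" for y
          proof (rule onorm_bound[OF M(1)])
            fix z
            show "norm (G y \<bullet> z) \<le> M * norm z"
              using Cauchy_Schwarz_ineq2[of "G y" z] mult_right_mono[OF M(2)[of y], of "norm z"] by simp
          qed
        qed (use deriv in auto)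
        then have "norm (f n x) \<le> real (Suc n) * (M * norm ?h)"
          by (simp add: f_def abs_mult del: of_nat_Suc)
        also have "\<dots> = M * norm b" by (simp add: field_simps)
        finally show ?thesis using True by simp
      next
        case False
        then have "R + norm b < norm x" by simp
        moreover have "norm x \<le> norm (x + ?h) + norm ?h"
          using norm_triangle_ineq4[of "x + ?h" ?h] by simp
        ultimately have "p x = 0" "p (x + ?h) = 0"
          using K(2) R h norm_ge_zero[of b] by (smt (verit))+
        then show ?thesis using M by (simp add: f_def)
      qed
    qed
  qed (auto simp: f_def)
  then show ?thesis using f0 by (simp add: LIMSEQ_const_iff)
qed

text \<open>The gradient of the product with a second test function integrates to zero. This places
  test functions in \<open>H1\<close>, so that \<open>H1_norm\<close> of \<open>f - \<phi>\<close>
  in the definition of \<open>H10\<close> obeys the norm laws instead of depending on an unspecified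
  choice.\<close>

lemma has_weak_grad_test_function:
  fixes \<phi> :: "'a::euclidean_space \<Rightarrow> real"
  assumes \<Omega>: "open \<Omega>" "bounded \<Omega>" and \<phi>: "\<phi> \<in> test_functions \<Omega>"
  shows "\<exists>G. has_weak_grad \<Omega> \<phi> G"
proof -
  obtain G K where G: "\<And>x. (\<phi> has_derivative (\<lambda>h. G x \<bullet> h)) (at x)" "continuous_on UNIV G"
    "compact K" "K \<subseteq> \<Omega>" "\<And>x. x \<notin> K \<Longrightarrow> \<phi> x = 0" "\<And>x. x \<notin> K \<Longrightarrow> G x = 0"
    using test_function_grad[OF \<phi>] by blast
  have GL2: "G \<in> L2 \<Omega>"
    using assms G by (intro compact_support_L2[where K = K]) auto
  have "(LINT x|lebesgue_on \<Omega>. \<phi> x * frechet_derivative \<psi> (at x) b) =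
      - (LINT x|lebesgue_on \<Omega>. (G x \<bullet> b) * \<psi> x)" if \<psi>: "\<psi> \<in> test_functions \<Omega>" for \<psi> b
  proof -
    obtain H K' where H: "\<And>x. (\<psi> has_derivative (\<lambda>h. H x \<bullet> h)) (at x)" "continuous_on UNIV H"
      "compact K'" "K' \<subseteq> \<Omega>" "\<And>x. x \<notin> K' \<Longrightarrow> \<psi> x = 0" "\<And>x. x \<notin> K' \<Longrightarrow> H x = 0"
    using test_function_grad[OF \<psi>] by blast
    let ?D = "\<lambda>x. \<phi> x *\<^sub>R H x + \<psi> x *\<^sub>R G x"
    have c: "continuous_on UNIV \<phi>" "continuous_on UNIV \<psi>"
      using G(1) H(1) by (auto intro!: continuous_at_imp_continuous_on has_derivative_continuous)
    have "((\<lambda>x. \<phi> x * \<psi> x) has_derivative (\<lambda>h. ?D x \<bullet> h)) (at x)" for x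
    proof -
      have "((\<lambda>x. \<phi> x * \<psi> x) has_derivative (\<lambda>h. \<phi> x * (H x \<bullet> h) + (G x \<bullet> h) * \<psi> x)) (at x)"
        by (rule has_derivative_mult[OF G(1) H(1)])
      then show ?thesis by (simp add: inner_add_left mult.commute)
    qed
    then have "(LINT x|lborel. ?D x \<bullet> b) = 0"
    proof (rule integral_partial_eq_0[OF _ _ G(3)])
      show "continuous_on UNIV ?D" by (intro continuous_intros c G(2) H(2))
    qed (simp_all add: G(5,6))
    moreover have "(LINT x|lebesgue_on \<Omega>. ?D x \<bullet> b) = (LINT x|lborel. ?D x \<bullet> b)"
    proof -
      have "(LINT x|lebesgue_on \<Omega>. ?D x \<bullet> b) = (LINT x|lebesgue. indicator \<Omega> x *\<^sub>R (?D x \<bullet> b))"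
        using \<Omega> by (intro integral_restrict_space) (auto intro: sets_completionI_sets)
      \<comment> \<open>Each summand of \<open>?D\<close> contains \<open>\<phi>\<close> or its
        gradient, hence vanishes off \<open>K\<close>, and \<open>K\<close> lies in
        \<open>\<Omega>\<close>.\<close>
      also have "(\<lambda>x. indicator \<Omega> x *\<^sub>R (?D x \<bullet> b)) = (\<lambda>x. ?D x \<bullet> b)"
        using G(4-6) by (force simp: indicator_def fun_eq_iff)
      also have "(LINT x|lebesgue. ?D x \<bullet> b) = (LINT x|lborel. ?D x \<bullet> b)"
        by (intro integral_completion)
          (auto intro!: borel_measurable_continuous_onI continuous_intros c G(2) H(2))
      finally show ?thesis .
    qed
    moreover have "(LINT x|lebesgue_on \<Omega>. ?D x \<bullet> b)
        = (LINT x|lebesgue_on \<Omega>. \<phi> x * (H x \<bullet> b)) + (LINT x|lebesgue_on \<Omega>. (G x \<bullet> b) * \<psi> x)"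
    proof -
      have "H \<in> L2 \<Omega>"
        using \<Omega> \<psi> H by (intro compact_support_L2[where K = "K'"]) auto
      then show ?thesis
        using L2_inner_integrable[OF test_function_L2[OF \<Omega> \<phi>] L2_component[of H]]
          L2_inner_integrable[OF L2_component[OF GL2] test_function_L2[OF \<Omega> \<psi>]]
        by (simp add: inner_add_left mult.commute[of "\<psi> _"])
    qed
    moreover have "frechet_derivative \<psi> (at x) b = H x \<bullet> b" for x
      using frechet_derivative_at[OF H(1)[of x]] by metis
    ultimately show ?thesis by simp
  qed
  then show ?thesis
    using GL2 test_function_L2[OF assms] unfolding has_weak_grad_def by blast
qed

section \<open>Uniqueness of the weak gradient\<close>

text \<open>A Dynkin argument: boxes are stable under intersection and generate the Borel sets, and
  the sets over which \<open>k\<close> integrates to 0 are closed under disjoint countable unions.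
  Closure under complements is where the total integral has to vanish.\<close>

lemma box_integrals_zero_imp_ae_zero:
  fixes k :: "'a::euclidean_space \<Rightarrow> real"
  assumes int: "integrable lebesgue k" and zero: "(LINT x|lebesgue. k x) = 0"
    and box: "\<And>a b. (LINT x:box a b|lebesgue. k x) = 0"
  shows "AE x in lebesgue. k x = 0"
proof (rule density_unique_real[OF int])
  show "integrable lebesgue (\<lambda>x. 0 :: real)" by simp
  have set_int: "set_integrable lebesgue A k" if "A \<in> sets lebesgue" for A
    unfolding set_integrable_def by (rule integrable_mult_indicator[OF that int])
  have borel: "(LINT x:A|lebesgue. k x) = 0" if "A \<in> sets borel" for A
  proof -
    have "Int_stable (range (\<lambda>(a, b). box a b :: 'a set))"
      by (auto simp: Int_stable_def box_Int_box)
    moreover have "range (\<lambda>(a, b). box a b) \<subseteq> Pow (UNIV :: 'a set)" by simp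
    moreover have "A \<in> sigma_sets UNIV (range (\<lambda>(a, b). box a b))"
      using that by (subst (asm) borel_eq_box) simp
    ultimately show ?thesis
    proof (induction rule: sigma_sets_induct_disjoint)
      case (basic A)
      then show ?case using box by auto
    next
      case empty
      then show ?case by (simp add: set_lebesgue_integral_def)
    next
      case (compl A)
      have A: "A \<in> sets lebesgue"
        using compl.hyps by (auto intro!: sets_completionI_sets simp: borel_eq_box)
      have "(LINT x:A \<union> (UNIV - A)|lebesgue. k x) = (LINT x:A|lebesgue. k x) + (LINT x:UNIV - A|lebesgue. k x)"
        using A by (intro set_integral_Un set_int) auto
      moreover have "A \<union> (UNIV - A) = UNIV" by auto
      ultimately show ?case using compl.IH zero by (simp add: set_lebesgue_integral_def)
    next
      case (union A)
      have A: "A i \<in> sets lebesgue" for i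
        using range_subsetD[OF union.hyps(2), of i] by (auto intro!: sets_completionI_sets simp: borel_eq_box)
      have "(LINT x:(\<Union>i. A i)|lebesgue. k x) = (\<Sum>i. LINT x:A i|lebesgue. k x)"
        using A union.hyps(1) by (intro lebesgue_integral_countable_add set_int)
          (auto simp: disjoint_family_on_def)
      then show ?case using union.IH by simp
    qed
  qed
  fix A :: "'a set" assume "A \<in> sets lebesgue"
  \<comment> \<open>A Lebesgue set differs from a Borel set by a null set, so the Borel case carries
    over to the completion.\<close>
  then obtain S N N' where N: "A = S \<union> N" "N \<subseteq> N'" "N' \<in> null_sets lborel" "S \<in> sets lborel"
    by (rule sets_completionE)
  have "(LINT x:A|lebesgue. k x) = (LINT x:S|lebesgue. k x)"
    unfolding set_lebesgue_integral_def
  proof (rule integral_cong_AE)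
    have [measurable]: "k \<in> borel_measurable lebesgue" "S \<in> sets lebesgue" "A \<in> sets lebesgue"
      using int N(4) \<open>A \<in> sets lebesgue\<close> by (auto intro: sets_completionI_sets)
    show "(\<lambda>x. indicator A x *\<^sub>R k x) \<in> borel_measurable lebesgue"
      "(\<lambda>x. indicator S x *\<^sub>R k x) \<in> borel_measurable lebesgue" by measurable
    have "N' \<in> null_sets lebesgue" using N(3) by (rule null_sets_completionI)
    then show "AE x in lebesgue. indicator A x *\<^sub>R k x = indicator S x *\<^sub>R k x"
      by (rule AE_I') (use N in \<open>auto simp: indicator_def\<close>)
  qed
  then show "(LINT x:A|lebesgue. k x) = (LINT x:A|lebesgue. 0)"
    using borel N(4) by (simp add: set_lebesgue_integral_def)
qed

text \<open>Dominated convergence of the bumps transfers orthogonality to indicators of boxes whose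
  closure lies in \<open>\<Omega>\<close>. Thus \<open>h\<close> vanishes almost everywhere on each
  such closed box, and countably many of them exhaust \<open>\<Omega>\<close>.\<close>

lemma fundamental_lemma_calculus_of_variations:
  fixes h :: "'a::euclidean_space \<Rightarrow> real"
  assumes \<Omega>: "open \<Omega>" "bounded \<Omega>" and h: "h \<in> L2 \<Omega>"
    and orth: "\<And>\<phi>. \<phi> \<in> test_functions \<Omega> \<Longrightarrow> L2_inner \<Omega> h \<phi> = 0"
  shows "ae_eq \<Omega> h (\<lambda>x. 0)"
proof -
  interpret finite_measure "lebesgue_on \<Omega>" using \<Omega> by (rule open_bounded_finite_measure)
  have \<Omega>m: "\<Omega> \<in> sets lebesgue" using \<Omega> by (auto intro: sets_completionI_sets)
  note [measurable] = L2_measurable[OF h]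
  \<comment> \<open>Since \<open>\<Omega>\<close> has finite measure, pairing with the constant 1
    yields integrability of \<open>h\<close> itself, the dominating function below.\<close>
  have "(\<lambda>x. 1) \<in> L2 \<Omega>" by (simp add: L2_def)
  from L2_inner_integrable[OF h this] have inth: "integrable (lebesgue_on \<Omega>) h" by simp
  have box\<Omega>: "(LINT x|lebesgue_on \<Omega>. indicator (box a b) x * h x) = 0" if "cbox a b \<subseteq> \<Omega>" for a b
  proof -
    have "(\<lambda>n. LINT x|lebesgue_on \<Omega>. box_bump a b n x * h x) \<longlonglongrightarrow>
        (LINT x|lebesgue_on \<Omega>. indicator (box a b) x * h x)"
    proof (rule integral_dominated_convergence)
      show "integrable (lebesgue_on \<Omega>) (\<lambda>x. norm (h x))" using inth by simp
      have [measurable]: "box_bump a b n \<in> borel_measurable (lebesgue_on \<Omega>)" for n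
        using test_function_L2[OF \<Omega> box_bump_test_function[OF that]] by (rule L2_measurable)
      show "(\<lambda>x. box_bump a b n x * h x) \<in> borel_measurable (lebesgue_on \<Omega>)" for n by measurable
      have "box a b \<inter> \<Omega> \<in> sets (lebesgue_on \<Omega>)"
        using \<Omega>m by (auto simp: sets_restrict_space_iff intro: sets_completionI_sets)
      then have [measurable]: "(indicator (box a b) :: 'a \<Rightarrow> real) \<in> borel_measurable (lebesgue_on \<Omega>)"
        by (subst borel_measurable_indicator_iff) simp
      show "(\<lambda>x. indicator (box a b) x * h x) \<in> borel_measurable (lebesgue_on \<Omega>)" by measurable
      show "AE x in lebesgue_on \<Omega>. (\<lambda>n. box_bump a b n x * h x) \<longlonglongrightarrow> indicator (box a b) x * h x"
        by (intro AE_I2 tendsto_mult box_bump_tendsto_indicator tendsto_const)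
      show "AE x in lebesgue_on \<Omega>. norm (box_bump a b n x * h x) \<le> norm (h x)" for n
        using box_bump_bounds[of a b n]
        by (intro AE_I2) (simp add: abs_mult mult_left_le_one_le)
    qed
    moreover have "(LINT x|lebesgue_on \<Omega>. box_bump a b n x * h x) = 0" for n
      using orth[OF box_bump_test_function[OF that, of n]] by (simp add: L2_inner_def mult.commute)
    ultimately show ?thesis by (simp add: LIMSEQ_const_iff)
  qed
  have ae_cbox: "AE x in lebesgue. x \<in> cbox a b \<longrightarrow> h x = 0" if "cbox a b \<subseteq> \<Omega>" for a b
  proof -
    \<comment> \<open>The cut-off to one box makes integrals over arbitrary boxes accessible,
      including those that leave \<open>\<Omega>\<close>.\<close>
    define k where "k x = indicator (box a b) x * (indicator \<Omega> x * h x)" for x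
    have b\<Omega>: "box a b \<subseteq> \<Omega>" using that box_subset_cbox by blast
    have intk: "integrable lebesgue k"
    proof -
      have "integrable lebesgue (\<lambda>x. indicator \<Omega> x *\<^sub>R h x)"
        using inth \<Omega>m by (subst (asm) integrable_restrict_space) (auto simp: set_integrable_def)
      moreover have "box a b \<in> sets lebesgue" by (auto intro: sets_completionI_sets)
      ultimately show ?thesis
        using integrable_mult_indicator[of "box a b" lebesgue "\<lambda>x. indicator \<Omega> x *\<^sub>R h x"]
        unfolding k_def by simp
    qed
    have boxk: "(LINT x:box c d|lebesgue. k x) = 0" for c d
    proof -
      \<comment> \<open>These are the corners of the intersection of the two boxes. Its closed
        version stays inside \<open>cbox a b\<close>, so \<open>box\<Omega>\<close> applies to
        it.\<close>
      define a' b' where "a' = (\<Sum>i\<in>Basis. max (c \<bullet> i) (a \<bullet> i) *\<^sub>R i)"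
        and "b' = (\<Sum>i\<in>Basis. min (d \<bullet> i) (b \<bullet> i) *\<^sub>R i)"
      have bx: "box c d \<inter> box a b = box a' b'" and "cbox c d \<inter> cbox a b = cbox a' b'"
        by (simp_all add: box_Int_box Int_interval a'_def b'_def)
      then have "cbox a' b' \<subseteq> \<Omega>" using that by blast
      have "(LINT x:box c d|lebesgue. k x) = (LINT x|lebesgue. indicator \<Omega> x *\<^sub>R (indicator (box a' b') x * h x))"
        unfolding set_lebesgue_integral_def k_def bx[symmetric]
        by (intro Bochner_Integration.integral_cong) (auto simp: indicator_def)
      also have "\<dots> = (LINT x|lebesgue_on \<Omega>. indicator (box a' b') x * h x)"
        using \<Omega>m by (intro integral_restrict_space[symmetric]) auto
      finally show ?thesis using box\<Omega>[OF \<open>cbox a' b' \<subseteq> \<Omega>\<close>] by simp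
    qed
    have "(LINT x|lebesgue. k x) = (LINT x:box a b|lebesgue. k x)"
      unfolding set_lebesgue_integral_def k_def
      by (intro Bochner_Integration.integral_cong) (auto simp: indicator_def)
    then have "(LINT x|lebesgue. k x) = 0" using boxk by simp
    then have "AE x in lebesgue. k x = 0"
      by (rule box_integrals_zero_imp_ae_zero[OF intk _ boxk])
    \<comment> \<open>The cut-off used the open box, while the covering consists of closed ones; the
      faces are negligible.\<close>
    moreover have "AE x in lebesgue. x \<notin> cbox a b - box a b"
      using negligible_frontier_interval[of a b]
      by (intro AE_not_in) (simp add: negligible_iff_null_sets)
    ultimately show ?thesis
      by eventually_elim (use b\<Omega> in \<open>auto simp: k_def indicator_def split: if_splits\<close>)
  qed
  obtain \<D> where \<D>: "countable \<D>" "\<D> \<subseteq> Pow \<Omega>" "\<And>X. X \<in> \<D> \<Longrightarrow> \<exists>a b. X = cbox a b" "\<Union>\<D> = \<Omega>"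
    using open_countable_Union_open_cbox[OF \<Omega>(1)] by metis
  have "\<forall>X\<in>\<D>. AE x in lebesgue. x \<in> X \<longrightarrow> h x = 0"
    using \<D>(2,3) ae_cbox by blast
  then have "AE x in lebesgue. \<forall>X\<in>\<D>. x \<in> X \<longrightarrow> h x = 0"
    by (subst AE_ball_countable[OF \<D>(1)])
  then have "AE x in lebesgue. x \<in> \<Omega> \<longrightarrow> h x = 0"
    by eventually_elim (use \<D>(4) in blast)
  then show ?thesis
    unfolding ae_eq_def using \<Omega>m by (subst AE_restrict_space_iff) auto
qed

section \<open>Linearity of the chosen weak gradient\<close>

lemma has_weak_grad_iff:
  "has_weak_grad \<Omega> f g \<longleftrightarrow> f \<in> L2 \<Omega> \<and> g \<in> L2 \<Omega> \<and> (\<forall>\<phi>\<in>test_functions \<Omega>. \<forall>b\<in>Basis.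
    L2_inner \<Omega> f (\<lambda>x. frechet_derivative \<phi> (at x) b) = - L2_inner \<Omega> (\<lambda>x. g x \<bullet> b) \<phi>)"
  by (simp add: has_weak_grad_def L2_inner_def)

text \<open>Each component of the difference is orthogonal to all test functions; the finitely many
  exceptional null sets are then combined.\<close>

lemma has_weak_grad_unique:
  fixes f :: "'a::euclidean_space \<Rightarrow> real"
  assumes \<Omega>: "open \<Omega>" "bounded \<Omega>" and g: "has_weak_grad \<Omega> f g" "has_weak_grad \<Omega> f g'"
  shows "ae_eq \<Omega> g g'"
proof -
  have L2: "g \<in> L2 \<Omega>" "g' \<in> L2 \<Omega>" using g by (auto simp: has_weak_grad_iff)
  have "AE x in lebesgue_on \<Omega>. g x \<bullet> b - g' x \<bullet> b = 0" if b: "b \<in> Basis" for b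
  proof -
    have "ae_eq \<Omega> (\<lambda>x. g x \<bullet> b - g' x \<bullet> b) (\<lambda>x. 0)"
    proof (rule fundamental_lemma_calculus_of_variations[OF \<Omega>])
      show "(\<lambda>x. g x \<bullet> b - g' x \<bullet> b) \<in> L2 \<Omega>"
        using L2 by (intro L2_diff L2_component)
      show "L2_inner \<Omega> (\<lambda>x. g x \<bullet> b - g' x \<bullet> b) \<phi> = 0" if "\<phi> \<in> test_functions \<Omega>" for \<phi>
        using g b that L2 test_function_L2[OF \<Omega> that]
        by (subst L2.diff_left) (auto simp: has_weak_grad_iff intro: L2_component)
    qed
    then show ?thesis by (simp add: ae_eq_def)
  qed
  then have "AE x in lebesgue_on \<Omega>. \<forall>b\<in>Basis. g x \<bullet> b - g' x \<bullet> b = 0"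
    by (intro AE_finite_allI) auto
  then show ?thesis
    unfolding ae_eq_def by eventually_elim (auto intro: euclidean_eqI)
qed

lemma has_weak_grad_add:
  assumes \<Omega>: "open \<Omega>" "bounded \<Omega>" and f: "has_weak_grad \<Omega> f f'" and g: "has_weak_grad \<Omega> g g'"
  shows "has_weak_grad \<Omega> (\<lambda>x. f x + g x) (\<lambda>x. f' x + g' x)"
  using f g test_function_L2[OF \<Omega>] test_function_partial_L2[OF \<Omega>]
  by (simp add: has_weak_grad_iff L2_add L2_inner_add inner_add_left L2_component)

lemma has_weak_grad_scale:
  assumes "has_weak_grad \<Omega> f f'"
  shows "has_weak_grad \<Omega> (\<lambda>x. c * f x) (\<lambda>x. c *\<^sub>R f' x)"
  using assms L2_scaleR[of f \<Omega> c] L2_scaleR[of f' \<Omega> c]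
    L2_inner_scaleR[of \<Omega> c f] L2_inner_scaleR[of \<Omega> c "\<lambda>x. f' x \<bullet> _"]
  by (simp add: has_weak_grad_iff)

lemma has_weak_grad_weak_grad: "f \<in> H1 \<Omega> \<Longrightarrow> has_weak_grad \<Omega> f (weak_grad \<Omega> f)"
  unfolding H1_def weak_grad_def mem_Collect_eq by (erule someI_ex)

lemma weak_grad_L2: "f \<in> H1 \<Omega> \<Longrightarrow> weak_grad \<Omega> f \<in> L2 \<Omega>"
  and H1_L2: "f \<in> H1 \<Omega> \<Longrightarrow> f \<in> L2 \<Omega>"
  using has_weak_grad_weak_grad by (auto simp: has_weak_grad_iff)

text \<open>Any weak gradient may replace the chosen one inside an inner product. In this way
  additivity and homogeneity of \<open>has_weak_grad\<close> pass to the Dirichlet form, although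
  \<open>weak_grad\<close> need not be pointwise linear.\<close>

lemma weak_grad_inner_unique:
  assumes "open \<Omega>" "bounded \<Omega>" "has_weak_grad \<Omega> f g" "h \<in> L2 \<Omega>"
  shows "L2_inner \<Omega> (weak_grad \<Omega> f) h = L2_inner \<Omega> g h"
proof -
  have f: "f \<in> H1 \<Omega>" using assms(3) by (auto simp: H1_def)
  then show ?thesis
    using assms has_weak_grad_unique[OF assms(1,2) has_weak_grad_weak_grad[OF f] assms(3)]
    by (intro L2_inner_cong_ae weak_grad_L2) (auto simp: has_weak_grad_iff)
qed

lemma semi_inner_space_Dirichlet:
  assumes \<Omega>: "open \<Omega>" "bounded \<Omega>"
  shows "semi_inner_space (H1 \<Omega>) (\<lambda>f g. L2_inner \<Omega> (weak_grad \<Omega> f) (weak_grad \<Omega> g))"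
proof
  show "(\<lambda>x. 0) \<in> H1 \<Omega>"
    unfolding H1_def mem_Collect_eq
    by (rule exI[of _ "\<lambda>x. 0"]) (simp add: L2_zero has_weak_grad_iff L2_inner_def)
  fix f g h :: "'a \<Rightarrow> real" and c :: real
  show "(\<lambda>x. f x + g x) \<in> H1 \<Omega>" if "f \<in> H1 \<Omega>" "g \<in> H1 \<Omega>"
    using that has_weak_grad_add[OF \<Omega>] unfolding H1_def by blast
  show "(\<lambda>x. c * f x) \<in> H1 \<Omega>" if "f \<in> H1 \<Omega>"
    using that has_weak_grad_scale unfolding H1_def by blast
  show "L2_inner \<Omega> (weak_grad \<Omega> (\<lambda>x. f x + g x)) (weak_grad \<Omega> h) =
      L2_inner \<Omega> (weak_grad \<Omega> f) (weak_grad \<Omega> h) + L2_inner \<Omega> (weak_grad \<Omega> g) (weak_grad \<Omega> h)"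
    if "f \<in> H1 \<Omega>" "g \<in> H1 \<Omega>" "h \<in> H1 \<Omega>"
    using weak_grad_inner_unique[OF \<Omega> has_weak_grad_add[OF \<Omega> that(1,2)[THEN has_weak_grad_weak_grad]]]
      that by (simp add: weak_grad_L2 L2_inner_add)
  show "L2_inner \<Omega> (weak_grad \<Omega> (\<lambda>x. c * f x)) (weak_grad \<Omega> h) =
      c * L2_inner \<Omega> (weak_grad \<Omega> f) (weak_grad \<Omega> h)" if "f \<in> H1 \<Omega>" "h \<in> H1 \<Omega>"
    using weak_grad_inner_unique[OF \<Omega> has_weak_grad_scale[OF that(1)[THEN has_weak_grad_weak_grad]]]
      that by (simp add: weak_grad_L2 L2_inner_scaleR)
qed (auto intro: L2_inner_commute L2_inner_self_nonneg)

lemma semi_inner_space_H1: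
  assumes \<Omega>: "open \<Omega>" "bounded \<Omega>"
  shows "semi_inner_space (H1 \<Omega>)
    (\<lambda>f g. L2_inner \<Omega> f g + L2_inner \<Omega> (weak_grad \<Omega> f) (weak_grad \<Omega> g))"
proof -
  interpret D: semi_inner_space "H1 \<Omega>" "\<lambda>f g. L2_inner \<Omega> (weak_grad \<Omega> f) (weak_grad \<Omega> g)"
    by (rule semi_inner_space_Dirichlet[OF \<Omega>])
  show ?thesis
  proof
    fix f g h :: "'a \<Rightarrow> real" and c :: real
    show "L2_inner \<Omega> f g + L2_inner \<Omega> (weak_grad \<Omega> f) (weak_grad \<Omega> g) =
        L2_inner \<Omega> g f + L2_inner \<Omega> (weak_grad \<Omega> g) (weak_grad \<Omega> f)"
      by (simp add: L2_inner_commute)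
  qed (simp_all add: D.zero_mem D.add_mem D.scale_mem D.add_left D.scale_left L2.add_left
      L2.scale_left H1_L2 L2_inner_self_nonneg distrib_left)
qed

section \<open>Subspaces and the linear structure of \<open>H10\<close>\<close>

lemma semi_inner_space_subset:
  assumes "semi_inner_space X B" "Y \<subseteq> X" "(\<lambda>x. 0) \<in> Y"
    and "\<And>f g. f \<in> Y \<Longrightarrow> g \<in> Y \<Longrightarrow> (\<lambda>x. f x + g x) \<in> Y"
    and "\<And>f c. f \<in> Y \<Longrightarrow> (\<lambda>x. c * f x) \<in> Y"
  shows "semi_inner_space Y B"
proof -
  interpret semi_inner_space X B by fact
  show ?thesis
    using assms(2-) by unfold_locales (auto intro: add_left scale_left nonneg sym)
qed

lemma H1_norm_eq: "semi_inner_space.N (\<lambda>f g. L2_inner \<Omega> f g + L2_inner \<Omega> (weak_grad \<Omega> f) (weak_grad \<Omega> g))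
    = H1_norm \<Omega>" if "open \<Omega>" "bounded \<Omega>"
  using semi_inner_space.N_def[OF semi_inner_space_H1[OF that]]
  by (auto simp: fun_eq_iff H1_norm_def L2_norm_def L2_inner_self_nonneg)

lemma H10_subset_H1: "H10 \<Omega> \<subseteq> H1 \<Omega>"
  by (auto simp: H10_def)

lemma test_function_add:
  assumes "\<phi> \<in> test_functions \<Omega>" "\<psi> \<in> test_functions \<Omega>"
  shows "(\<lambda>x. \<phi> x + \<psi> x) \<in> test_functions \<Omega>"
proof -
  have sub: "closure {x. \<phi> x + \<psi> x \<noteq> 0} \<subseteq> closure {x. \<phi> x \<noteq> 0} \<union> closure {x. \<psi> x \<noteq> 0}"
    unfolding closure_Un[symmetric] by (intro closure_mono) auto
  have "bounded (closure {x. \<phi> x \<noteq> 0} \<union> closure {x. \<psi> x \<noteq> 0})"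
    using assms by (intro bounded_Un[THEN iffD2] conjI compact_imp_bounded) (auto simp: test_functions_def)
  from bounded_subset[OF this sub] have "compact (closure {x. \<phi> x + \<psi> x \<noteq> 0})"
    by (simp only: compact_eq_bounded_closed closed_closure simp_thms)
  then show ?thesis
    using assms sub unfolding test_functions_def by (auto intro: Ck_add dest: subsetD)
qed

lemma test_function_scale:
  assumes "\<phi> \<in> test_functions \<Omega>"
  shows "(\<lambda>x. c * \<phi> x) \<in> test_functions \<Omega>"
proof -
  have sub: "closure {x. c * \<phi> x \<noteq> 0} \<subseteq> closure {x. \<phi> x \<noteq> 0}"
    by (intro closure_mono) auto
  have "bounded (closure {x. \<phi> x \<noteq> 0})"
    using assms by (intro compact_imp_bounded) (simp add: test_functions_def)
  from bounded_subset[OF this sub] have "compact (closure {x. c * \<phi> x \<noteq> 0})"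
    by (simp only: compact_eq_bounded_closed closed_closure simp_thms)
  then show ?thesis
    using assms sub unfolding test_functions_def by (auto intro: Ck_mult Ck_const dest: subsetD)
qed

section \<open>Weak solutions\<close>

lemma test_function_H1:
  "open \<Omega> \<Longrightarrow> bounded \<Omega> \<Longrightarrow> \<phi> \<in> test_functions \<Omega> \<Longrightarrow> \<phi> \<in> H1 \<Omega>"
  using has_weak_grad_test_function by (auto simp: H1_def)

text \<open>Sums and multiples of approximating test functions approximate the sums and multiples,
  by the triangle inequality and homogeneity of \<open>H1_norm\<close> on \<open>H1\<close>.\<close>

lemma H10_subspace:
  assumes \<Omega>: "open \<Omega>" "bounded \<Omega>"
  shows "(\<lambda>x. 0) \<in> H10 \<Omega>"
    and "f \<in> H10 \<Omega> \<Longrightarrow> g \<in> H10 \<Omega> \<Longrightarrow> (\<lambda>x. f x + g x) \<in> H10 \<Omega>"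
    and "f \<in> H10 \<Omega> \<Longrightarrow> (\<lambda>x. c * f x) \<in> H10 \<Omega>"
proof -
  interpret semi_inner_space "H1 \<Omega>" "\<lambda>f g. L2_inner \<Omega> f g + L2_inner \<Omega> (weak_grad \<Omega> f) (weak_grad \<Omega> g)"
    rewrites "semi_inner_space.N (\<lambda>f g. L2_inner \<Omega> f g + L2_inner \<Omega> (weak_grad \<Omega> f) (weak_grad \<Omega> g)) = H1_norm \<Omega>"
    by (rule semi_inner_space_H1[OF \<Omega>], rule H1_norm_eq[OF \<Omega>])
  note test_H1 = test_function_H1[OF \<Omega>]
  have approx: "\<exists>\<phi>\<in>test_functions \<Omega>. H1_norm \<Omega> (\<lambda>x. f x - \<phi> x) < \<epsilon>" if "f \<in> H10 \<Omega>" "\<epsilon> > 0" for f \<epsilon>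
    using that by (simp add: H10_def)
  have zero_test: "(\<lambda>x. 0) \<in> test_functions \<Omega>"
    by (simp add: test_functions_def Ck_const)
  show "(\<lambda>x. 0) \<in> H10 \<Omega>"
    using zero_mem zero_test N_zero unfolding H10_def by (auto intro!: bexI[of _ "\<lambda>x. 0"])
  show "(\<lambda>x. f x + g x) \<in> H10 \<Omega>" if f: "f \<in> H10 \<Omega>" and g: "g \<in> H10 \<Omega>"
    unfolding H10_def
  proof (intro CollectI conjI allI impI)
    have fg: "f \<in> H1 \<Omega>" "g \<in> H1 \<Omega>" using f g H10_subset_H1 by auto
    then show "(\<lambda>x. f x + g x) \<in> H1 \<Omega>" by (rule add_mem)
    fix \<epsilon> :: real assume "\<epsilon> > 0"
    then obtain \<phi> \<psi> where \<phi>: "\<phi> \<in> test_functions \<Omega>" "H1_norm \<Omega> (\<lambda>x. f x - \<phi> x) < \<epsilon> / 2"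
      and \<psi>: "\<psi> \<in> test_functions \<Omega>" "H1_norm \<Omega> (\<lambda>x. g x - \<psi> x) < \<epsilon> / 2"
      using approx[OF f, of "\<epsilon> / 2"] approx[OF g, of "\<epsilon> / 2"] by auto
    have "H1_norm \<Omega> (\<lambda>x. (f x - \<phi> x) + (g x - \<psi> x)) < \<epsilon>"
      using N_triangle[OF diff_mem[OF fg(1) test_H1[OF \<phi>(1)]] diff_mem[OF fg(2) test_H1[OF \<psi>(1)]]] \<phi>(2) \<psi>(2)
      by linarith
    moreover have "(\<lambda>x. (f x - \<phi> x) + (g x - \<psi> x)) = (\<lambda>x. f x + g x - (\<phi> x + \<psi> x))" by auto
    ultimately show "\<exists>\<phi>\<in>test_functions \<Omega>. H1_norm \<Omega> (\<lambda>x. f x + g x - \<phi> x) < \<epsilon>"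
      using test_function_add[OF \<phi>(1) \<psi>(1)] by (intro bexI[of _ "\<lambda>x. \<phi> x + \<psi> x"]) simp_all
  qed
  show "(\<lambda>x. c * f x) \<in> H10 \<Omega>" if f: "f \<in> H10 \<Omega>"
    unfolding H10_def
  proof (intro CollectI conjI allI impI)
    have f1: "f \<in> H1 \<Omega>" using f H10_subset_H1 by auto
    then show "(\<lambda>x. c * f x) \<in> H1 \<Omega>" by (rule scale_mem)
    fix \<epsilon> :: real assume "\<epsilon> > 0"
    \<comment> \<open>The added 1 covers c = 0.\<close>
    then have "\<epsilon> / (\<bar>c\<bar> + 1) > 0" by (simp add: add_nonneg_pos)
    then obtain \<phi> where \<phi>: "\<phi> \<in> test_functions \<Omega>" "H1_norm \<Omega> (\<lambda>x. f x - \<phi> x) < \<epsilon> / (\<bar>c\<bar> + 1)"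
      using approx[OF f] by auto
    have m: "(\<lambda>x. f x - \<phi> x) \<in> H1 \<Omega>" by (rule diff_mem[OF f1 test_H1[OF \<phi>(1)]])
    have "H1_norm \<Omega> (\<lambda>x. c * (f x - \<phi> x)) = \<bar>c\<bar> * H1_norm \<Omega> (\<lambda>x. f x - \<phi> x)"
      by (rule N_scale[OF m])
    also have "\<dots> \<le> (\<bar>c\<bar> + 1) * H1_norm \<Omega> (\<lambda>x. f x - \<phi> x)"
      using N_nonneg[OF m] by (intro mult_right_mono) auto
    also have "\<dots> < \<epsilon>" using \<phi>(2) by (simp add: field_simps add_nonneg_pos)
    finally have "H1_norm \<Omega> (\<lambda>x. c * f x - c * \<phi> x) < \<epsilon>" by (simp add: right_diff_distrib)
    then show "\<exists>\<phi>\<in>test_functions \<Omega>. H1_norm \<Omega> (\<lambda>x. c * f x - \<phi> x) < \<epsilon>"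
      using test_function_scale[OF \<phi>(1)] by (intro bexI[of _ "\<lambda>x. c * \<phi> x"]) simp_all
  qed
qed

lemma semi_inner_space_H10:
  assumes "open \<Omega>" "bounded \<Omega>"
  shows "semi_inner_space (H10 \<Omega>)
    (\<lambda>f g. L2_inner \<Omega> f g + L2_inner \<Omega> (weak_grad \<Omega> f) (weak_grad \<Omega> g))"
  by (intro semi_inner_space_subset[OF semi_inner_space_H1[OF assms] H10_subset_H1] H10_subspace[OF assms])

lemma semi_inner_space_H10_Dirichlet:
  assumes "open \<Omega>" "bounded \<Omega>"
  shows "semi_inner_space (H10 \<Omega>) (\<lambda>f g. L2_inner \<Omega> (weak_grad \<Omega> f) (weak_grad \<Omega> g))"
  by (intro semi_inner_space_subset[OF semi_inner_space_Dirichlet[OF assms] H10_subset_H1] H10_subspace[OF assms])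

lemma H10_L2: "f \<in> H10 \<Omega> \<Longrightarrow> f \<in> L2 \<Omega>"
  using H10_subset_H1 H1_L2 by blast

lemma L2_norm_le_H1_norm: "L2_norm \<Omega> f \<le> H1_norm \<Omega> f"
  unfolding H1_norm_def by (rule real_le_rsqrt) simp

section \<open>The dual space and its pairing with \<open>H10\<close>\<close>

lemma Hm1_bound:
  assumes "l \<in> Hm1 \<Omega>"
  obtains M where "\<And>f. f \<in> H10 \<Omega> \<Longrightarrow> \<bar>l f\<bar> \<le> M * H1_norm \<Omega> f"
  using assms unfolding Hm1_def by blast

text \<open>Homogeneity reduces the claim to an element of norm 1. The dual norm is a supremum of
  reals, so it dominates its members only once the set is known to be bounded above; the constant
  from membership in \<open>Hm1\<close> gives this.\<close>

lemma Hm1_apply_le: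
  assumes \<Omega>: "open \<Omega>" "bounded \<Omega>" and l: "l \<in> Hm1 \<Omega>" and f: "f \<in> H10 \<Omega>"
  shows "\<bar>l f\<bar> \<le> Hm1_norm \<Omega> l * H1_norm \<Omega> f"
proof -
  interpret semi_inner_space "H10 \<Omega>" "\<lambda>f g. L2_inner \<Omega> f g + L2_inner \<Omega> (weak_grad \<Omega> f) (weak_grad \<Omega> g)"
    rewrites "semi_inner_space.N (\<lambda>f g. L2_inner \<Omega> f g + L2_inner \<Omega> (weak_grad \<Omega> f) (weak_grad \<Omega> g)) = H1_norm \<Omega>"
    by (rule semi_inner_space_H10[OF \<Omega>], rule H1_norm_eq[OF \<Omega>])
  obtain M where M: "\<And>g. g \<in> H10 \<Omega> \<Longrightarrow> \<bar>l g\<bar> \<le> M * H1_norm \<Omega> g"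
    using Hm1_bound[OF l] by blast
  show ?thesis
  proof (cases "H1_norm \<Omega> f = 0")
    case True
    \<comment> \<open>An element of norm 0 cannot be normalised, but the bound \<open>M\<close>
      already forces \<open>l f = 0\<close>.\<close>
    then show ?thesis using M[OF f] by simp
  next
    case False
    then have pos: "H1_norm \<Omega> f > 0" using N_nonneg[OF f] by simp
    let ?g = "\<lambda>x. inverse (H1_norm \<Omega> f) * f x"
    have g: "?g \<in> H10 \<Omega>" "H1_norm \<Omega> ?g = 1"
      using f pos by (simp_all add: scale_mem N_scale)
    have "\<bar>l g\<bar> \<le> \<bar>M\<bar>" if "g \<in> H10 \<Omega>" "H1_norm \<Omega> g \<le> 1" for g
      using M[OF that(1)] mult_mono[of M "\<bar>M\<bar>" "H1_norm \<Omega> g" 1] N_nonneg[OF that(1)] that(2)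
          abs_ge_self[of M] by linarith
    then have "bdd_above ((\<lambda>g. \<bar>l g\<bar>) ` {g \<in> H10 \<Omega>. H1_norm \<Omega> g \<le> 1})"
      by (intro bdd_aboveI[of _ "\<bar>M\<bar>"]) auto
    then have "\<bar>l ?g\<bar> \<le> Hm1_norm \<Omega> l"
      unfolding Hm1_norm_def by (rule cSUP_upper[rotated]) (use g in simp)
    moreover have "l ?g = inverse (H1_norm \<Omega> f) * l f"
      using l f unfolding Hm1_def by blast
    ultimately have "inverse (H1_norm \<Omega> f) * \<bar>l f\<bar> \<le> Hm1_norm \<Omega> l"
      using pos by (simp only: abs_mult abs_inverse abs_of_pos)
    then show ?thesis using pos by (simp add: field_simps)
  qed
qed

lemma L2_inner_Hm1:
  assumes "f \<in> L2 \<Omega>"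
  shows "L2_inner \<Omega> f \<in> Hm1 \<Omega>"
  unfolding Hm1_def
proof (intro CollectI conjI ballI allI exI)
  fix g assume g: "g \<in> H10 \<Omega>"
  have "\<bar>L2_inner \<Omega> f g\<bar> \<le> L2_norm \<Omega> f * L2_norm \<Omega> g"
    by (rule L2.Cauchy_Schwarz[OF assms H10_L2[OF g]])
  also have "\<dots> \<le> L2_norm \<Omega> f * H1_norm \<Omega> g"
    by (intro mult_left_mono L2_norm_le_H1_norm L2.N_nonneg assms)
  finally show "\<bar>L2_inner \<Omega> f g\<bar> \<le> L2_norm \<Omega> f * H1_norm \<Omega> g" .
qed (use assms in \<open>auto simp: L2.add_right L2.scale_right H10_L2\<close>)

lemma Hm1_diff:
  assumes "l \<in> Hm1 \<Omega>" "m \<in> Hm1 \<Omega>"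
  shows "(\<lambda>f. l f - m f) \<in> Hm1 \<Omega>"
proof -
  obtain L M where "\<And>f. f \<in> H10 \<Omega> \<Longrightarrow> \<bar>l f\<bar> \<le> L * H1_norm \<Omega> f" "\<And>f. f \<in> H10 \<Omega> \<Longrightarrow> \<bar>m f\<bar> \<le> M * H1_norm \<Omega> f"
    using Hm1_bound[OF assms(1)] Hm1_bound[OF assms(2)] by metis
  then have "\<bar>l f - m f\<bar> \<le> (L + M) * H1_norm \<Omega> f" if "f \<in> H10 \<Omega>" for f
    using that abs_triangle_ineq4[of "l f" "m f"] by (fastforce simp: distrib_right)
  then show ?thesis
    using assms by (auto simp: Hm1_def right_diff_distrib intro!: exI[of _ "L + M"])
qed

lemma Hm1_divide:
  assumes "l \<in> Hm1 \<Omega>"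
  shows "(\<lambda>f. l f / c) \<in> Hm1 \<Omega>"
proof -
  obtain L where "\<And>f. f \<in> H10 \<Omega> \<Longrightarrow> \<bar>l f\<bar> \<le> L * H1_norm \<Omega> f"
    using Hm1_bound[OF assms] by blast
  then have "\<bar>l f / c\<bar> \<le> (L / \<bar>c\<bar>) * H1_norm \<Omega> f" if "f \<in> H10 \<Omega>" for f
    using divide_right_mono[of "\<bar>l f\<bar>" "L * H1_norm \<Omega> f" "\<bar>c\<bar>"] that by simp
  then show ?thesis
    using assms by (auto simp: Hm1_def add_divide_distrib intro!: exI[of _ "L / \<bar>c\<bar>"])
qed

text \<open>The error of the difference quotient is a functional in \<open>Hm1\<close>; its value at
  \<open>\<phi>\<close> is at most its dual norm times a constant. Differentiation in the dual norm
  thereby becomes scalar differentiation against each fixed test element.\<close>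

lemma has_real_derivative_pairing:
  assumes \<Omega>: "open \<Omega>" "bounded \<Omega>"
    and deriv: "has_derivative_in J (Hm1_norm \<Omega>) (\<lambda>t. L2_inner \<Omega> (v t)) v'"
    and v: "\<And>s. s \<in> J \<Longrightarrow> v s \<in> L2 \<Omega>" and v': "v' t \<in> Hm1 \<Omega>" and t: "t \<in> J" and \<phi>: "\<phi> \<in> H10 \<Omega>"
  shows "((\<lambda>s. L2_inner \<Omega> (v s) \<phi>) has_real_derivative v' t \<phi>) (at t within J)"
  unfolding has_field_derivative_iff
proof (rule LIM_zero_cancel, rule tendsto_0_le[where K = 1])
  let ?l = "\<lambda>s f. (L2_inner \<Omega> (v s) f - L2_inner \<Omega> (v t) f) / (s - t) - v' t f"
  have "((\<lambda>s. Hm1_norm \<Omega> (?l s)) \<longlongrightarrow> 0) (at t within J)"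
    using deriv t by (simp add: has_derivative_in_def)
  from tendsto_mult_left_zero[OF this]
  show "((\<lambda>s. Hm1_norm \<Omega> (?l s) * H1_norm \<Omega> \<phi>) \<longlongrightarrow> 0) (at t within J)" .
  have "\<bar>?l s \<phi>\<bar> \<le> Hm1_norm \<Omega> (?l s) * H1_norm \<Omega> \<phi>" if "s \<in> J" for s
    using that v v' t by (intro Hm1_apply_le[OF \<Omega> _ \<phi>] Hm1_diff Hm1_divide L2_inner_Hm1) auto
  then show "\<forall>\<^sub>F s in at t within J. norm (?l s \<phi>) \<le> norm (Hm1_norm \<Omega> (?l s) * H1_norm \<Omega> \<phi>) * 1"
    unfolding eventually_at_filter
    by (intro always_eventually allI impI) (simp, meson abs_ge_self order_trans)
qed

text \<open>Continuity in a stronger seminorm implies continuity in a weaker one. A curve in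
  \<open>H10\<close> is thus also a curve for the \<open>L2\<close> norm and for the Dirichlet
  seminorm.\<close>

lemma C_in_mono:
  assumes "u \<in> C_in J X p" "X \<subseteq> Y" "\<And>f g. f \<in> X \<Longrightarrow> g \<in> X \<Longrightarrow> (\<lambda>x. f x - g x) \<in> X"
    and q: "\<And>f. f \<in> X \<Longrightarrow> 0 \<le> q f" "\<And>f. f \<in> X \<Longrightarrow> q f \<le> p f"
  shows "u \<in> C_in J Y q"
  unfolding C_in_def
proof (intro CollectI ballI conjI)
  fix t assume t: "t \<in> J"
  have u: "u s \<in> X" if "s \<in> J" for s using assms(1) that by (simp add: C_in_def)
  then show "u t \<in> Y" using t assms(2) by auto
  have lim: "((\<lambda>s. p (\<lambda>x. u s x - u t x)) \<longlongrightarrow> 0) (at t within J)"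
    using assms(1) t by (simp add: C_in_def)
  have "norm (q (\<lambda>x. u s x - u t x)) \<le> norm (p (\<lambda>x. u s x - u t x)) * 1" if "s \<in> J" for s
    using q[OF assms(3)[OF u[OF that] u[OF t]]] by simp
  then show "((\<lambda>s. q (\<lambda>x. u s x - u t x)) \<longlongrightarrow> 0) (at t within J)"
    by (intro tendsto_0_le[OF lim, where K = 1]) (auto simp: eventually_at_filter intro!: always_eventually)
qed

section \<open>The nonlinearity along curves\<close>

lemma C_in_continuous_operator:
  assumes F: "\<And>f. f \<in> L2 \<Omega> \<Longrightarrow> F f \<in> L2 \<Omega>" "continuous_on_L2 \<Omega> F"
    and u: "u \<in> C_in J (L2 \<Omega>) (L2_norm \<Omega>)"
  shows "(\<lambda>t. F (u t)) \<in> C_in J (L2 \<Omega>) (L2_norm \<Omega>)"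
  unfolding C_in_def
proof (intro CollectI ballI conjI)
  fix t assume t: "t \<in> J"
  note mem = L2.C_in_mem[OF u]
  show "F (u t) \<in> L2 \<Omega>" using F(1) mem t by blast
  have lim: "((\<lambda>s. L2_norm \<Omega> (\<lambda>x. u s x - u t x)) \<longlongrightarrow> 0) (at t within J)"
    using u t by (simp add: C_in_def)
  show "((\<lambda>s. L2_norm \<Omega> (\<lambda>x. F (u s) x - F (u t) x)) \<longlongrightarrow> 0) (at t within J)"
  proof (rule tendstoI)
    fix \<epsilon> :: real assume "\<epsilon> > 0"
    then obtain \<delta> where \<delta>: "\<delta> > 0" "\<And>g. g \<in> L2 \<Omega> \<Longrightarrow> L2_norm \<Omega> (\<lambda>x. g x - u t x) < \<delta> \<Longrightarrow>
        L2_norm \<Omega> (\<lambda>x. F g x - F (u t) x) < \<epsilon>"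
      using bspec[OF F(2)[unfolded continuous_on_L2_def] mem[OF t]] by blast
    have "\<forall>\<^sub>F s in at t within J. s \<in> J" by (auto simp: eventually_at_filter)
    moreover have "\<forall>\<^sub>F s in at t within J. dist (L2_norm \<Omega> (\<lambda>x. u s x - u t x)) 0 < \<delta>"
      by (rule tendstoD[OF lim \<delta>(1)])
    ultimately show "\<forall>\<^sub>F s in at t within J. dist (L2_norm \<Omega> (\<lambda>x. F (u s) x - F (u t) x)) 0 < \<epsilon>"
    proof eventually_elim
      case (elim s)
      then have "L2_norm \<Omega> (\<lambda>x. F (u s) x - F (u t) x) < \<epsilon>"
        using \<delta>(2) mem by simp
      then show ?case
        using L2.N_nonneg[OF L2_diff[OF F(1) F(1)]] mem elim(1) t by simp
    qed
  qed
qed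

lemma continuous_on_less_nearby:
  fixes f :: "real \<Rightarrow> real"
  assumes "continuous_on S f" "x \<in> S" "f x < r"
  obtains d where "d > 0" "\<And>t. t \<in> S \<Longrightarrow> dist t x < d \<Longrightarrow> f t < r"
proof -
  obtain d where d: "d > 0" "\<And>t. t \<in> S \<Longrightarrow> dist t x < d \<Longrightarrow> dist (f t) (f x) < r - f x"
    using assms unfolding continuous_on_iff by (metis diff_gt_0_iff_gt)
  have "f t < r" if "t \<in> S" "dist t x < d" for t
    using d(2)[OF that] by (simp add: dist_real_def)
  then show ?thesis using d(1) that by blast
qed

text \<open>
  Along two curves the local Lipschitz constants can be replaced by a single one: where the curves
  meet, local Lipschitz continuity applies, and where they differ the quotient is continuous.
\<close>

lemma locally_lipschitz_along_curves:
  assumes "0 \<le> T" and F: "\<And>f. f \<in> L2 \<Omega> \<Longrightarrow> F f \<in> L2 \<Omega>" "continuous_on_L2 \<Omega> F"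
    and lip: "locally_lipschitz_L2 \<Omega> F"
    and u: "u \<in> C_in {0..T} (L2 \<Omega>) (L2_norm \<Omega>)" and v: "v \<in> C_in {0..T} (L2 \<Omega>) (L2_norm \<Omega>)"
  obtains L where "0 \<le> L" "\<And>t. t \<in> {0..T} \<Longrightarrow>
    L2_norm \<Omega> (\<lambda>x. F (u t) x - F (v t) x) \<le> L * L2_norm \<Omega> (\<lambda>x. u t x - v t x)"
proof -
  note mem = L2.C_in_mem[OF u] L2.C_in_mem[OF v]
  define n where "n t = L2_norm \<Omega> (\<lambda>x. u t x - v t x)" for t
  define m where "m t = L2_norm \<Omega> (\<lambda>x. F (u t) x - F (v t) x)" for t
  have cn: "continuous_on {0..T} n"
    unfolding n_def by (intro L2.continuous_on_N L2.C_in_diff u v)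
  have cm: "continuous_on {0..T} m"
    unfolding m_def by (intro L2.continuous_on_N L2.C_in_diff C_in_continuous_operator[where F = F] F u v)
  have n0: "0 \<le> n t" if "t \<in> {0..T}" for t
    using that mem unfolding n_def by (intro L2.N_nonneg L2_diff)
  have m0: "0 \<le> m t" if "t \<in> {0..T}" for t
    using that mem unfolding m_def by (intro L2.N_nonneg L2_diff F)
  define P where "P a b \<longleftrightarrow> (\<exists>L\<ge>0. \<forall>t\<in>{a..b} \<inter> {0..T}. m t \<le> L * n t)" for a b
  \<comment> \<open>Compactness enters as Bolzano's bisection principle: \<open>P\<close> passes to
    adjacent intervals with the larger constant, and it holds on all short intervals around each
    point.\<close>
  have "P 0 T"
    using \<open>0 \<le> T\<close>
  proof (induction rule: Bolzano)
    case (trans a b c)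
    then obtain L M where L: "L \<ge> 0" "\<And>t. t \<in> {a..b} \<inter> {0..T} \<Longrightarrow> m t \<le> L * n t"
      and M: "M \<ge> 0" "\<And>t. t \<in> {b..c} \<inter> {0..T} \<Longrightarrow> m t \<le> M * n t"
      unfolding P_def by blast
    have "m t \<le> max L M * n t" if t: "t \<in> {a..c} \<inter> {0..T}" for t
    proof -
      have "L * n t \<le> max L M * n t" "M * n t \<le> max L M * n t"
        using n0[of t] t by (auto intro: mult_right_mono)
      moreover have "m t \<le> L * n t \<or> m t \<le> M * n t"
        using L(2)[of t] M(2)[of t] t by (cases "t \<le> b") auto
      ultimately show ?thesis by linarith
    qed
    then show ?case unfolding P_def using L(1) by (intro exI[of _ "max L M"]) auto
  next
    case (local x)
    then have x: "x \<in> {0..T}" by simp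
    have "\<exists>d>0. \<exists>L\<ge>0. \<forall>t\<in>{0..T}. dist t x < d \<longrightarrow> m t \<le> L * n t"
    proof (cases "n x = 0")
      case True
      obtain r L where r: "r > 0" and L: "\<And>g h. g \<in> L2 \<Omega> \<Longrightarrow> h \<in> L2 \<Omega> \<Longrightarrow>
          L2_norm \<Omega> (\<lambda>y. g y - u x y) < r \<Longrightarrow> L2_norm \<Omega> (\<lambda>y. h y - u x y) < r \<Longrightarrow>
          L2_norm \<Omega> (\<lambda>y. F g y - F h y) \<le> L * L2_norm \<Omega> (\<lambda>y. g y - h y)"
        using bspec[OF lip[unfolded locally_lipschitz_L2_def] mem(1)[OF x]] by blast
      have cu: "continuous_on {0..T} (\<lambda>t. L2_norm \<Omega> (\<lambda>y. u t y - u x y))"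
        by (intro L2.continuous_on_N L2.C_in_diff u L2.const_in_C_in mem x)
      have cv: "continuous_on {0..T} (\<lambda>t. L2_norm \<Omega> (\<lambda>y. v t y - u x y))"
        by (intro L2.continuous_on_N L2.C_in_diff v L2.const_in_C_in mem x)
      have "L2_norm \<Omega> (\<lambda>y. u x y - u x y) = 0"
        by (simp add: L2.N_zero)
      then obtain d1 where d1: "d1 > 0" "\<And>t. t \<in> {0..T} \<Longrightarrow> dist t x < d1 \<Longrightarrow> L2_norm \<Omega> (\<lambda>y. u t y - u x y) < r"
        using continuous_on_less_nearby[OF cu x, of r] r by auto
      \<comment> \<open>The values need not be the same function, only at seminorm distance 0. That
        suffices for both curves to stay in the Lipschitz ball around \<open>u x\<close> for a short
        time.\<close>
      have "L2_norm \<Omega> (\<lambda>y. v x y - u x y) = 0"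
        using L2.N_minus_commute[OF mem[OF x]] True by (simp add: n_def)
      then obtain d2 where d2: "d2 > 0" "\<And>t. t \<in> {0..T} \<Longrightarrow> dist t x < d2 \<Longrightarrow> L2_norm \<Omega> (\<lambda>y. v t y - u x y) < r"
        using continuous_on_less_nearby[OF cv x, of r] r by auto
      \<comment> \<open>Local Lipschitz continuity does not state the sign of \<open>L\<close>,
        whereas \<open>P\<close> asks for a nonnegative constant.\<close>
      have "m t \<le> max L 0 * n t" if t: "t \<in> {0..T}" "dist t x < min d1 d2" for t
      proof -
        have "m t \<le> L * n t"
          unfolding m_def n_def using t d1(2) d2(2) mem by (intro L) auto
        also have "\<dots> \<le> max L 0 * n t" using n0[OF t(1)] by (intro mult_right_mono) auto
        finally show ?thesis .
      qed
      then show ?thesis using d1 d2 by (intro exI[of _ "min d1 d2"] conjI exI[of _ "max L 0"]) auto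
    next
      case False
      then have nx: "n x > 0" using n0[OF x] by simp
      obtain d1 where d1: "d1 > 0" "\<And>t. t \<in> {0..T} \<Longrightarrow> dist t x < d1 \<Longrightarrow> - n t < - (n x / 2)"
        using continuous_on_less_nearby[OF continuous_on_minus[OF cn] x, of "- (n x / 2)"] nx by auto
      obtain d2 where d2: "d2 > 0" "\<And>t. t \<in> {0..T} \<Longrightarrow> dist t x < d2 \<Longrightarrow> m t < m x + 1"
        using continuous_on_less_nearby[OF cm x, of "m x + 1"] by auto
      \<comment> \<open>Near \<open>x\<close> the numerator \<open>m\<close> stays below
        \<open>m x + 1\<close> and the denominator \<open>n\<close> above \<open>n x / 2\<close>;
        this is the resulting bound on the quotient.\<close>
      let ?L = "2 * (m x + 1) / n x"
      have L0: "?L \<ge> 0" using nx m0[OF x] by simp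
      have "m t \<le> ?L * n t" if t: "t \<in> {0..T}" "dist t x < min d1 d2" for t
      proof -
        have "n x / 2 \<le> n t" using d1(2)[of t] t by simp
        then have "?L * (n x / 2) \<le> ?L * n t" using L0 by (rule mult_left_mono)
        moreover have "m t \<le> m x + 1" using d2(2)[of t] t by simp
        ultimately show ?thesis using nx by simp
      qed
      then show ?thesis using d1 d2 L0 by (intro exI[of _ "min d1 d2"] conjI exI[of _ ?L]) auto
    qed
    then obtain d L where d: "d > 0" "L \<ge> 0" "\<And>t. t \<in> {0..T} \<Longrightarrow> dist t x < d \<Longrightarrow> m t \<le> L * n t"
      by blast
    have "P a b" if "a \<le> x" "x \<le> b" "b - a < d" for a b
      unfolding P_def using that d(2,3) by (intro exI[of _ L]) (auto simp: dist_real_def)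
    then show ?case using d(1) by blast
  qed
  then show ?thesis using that unfolding P_def m_def n_def by auto
qed

text \<open>The difference is fed to \<open>damped_wave_zero\<close> with pivot space
  \<open>L2\<close> and with the Dirichlet form on \<open>H10\<close>. The full
  \<open>H1_norm\<close> is needed as well, because continuity of the solutions and admissibility of
  test functions are expressed in it.\<close>

lemma weak_solution_unique:
  fixes \<Omega> :: "'a::euclidean_space set"
  assumes \<Omega>: "open \<Omega>" "bounded \<Omega>" and pos: "0 \<le> \<nu>" "0 \<le> \<kappa>" and "0 \<le> T"
    and F: "\<And>f. f \<in> L2 \<Omega> \<Longrightarrow> F f \<in> L2 \<Omega>" "continuous_on_L2 \<Omega> F" "locally_lipschitz_L2 \<Omega> F"
    and u: "weak_solution \<Omega> \<nu> \<kappa> F u0 v0 T u" and v: "weak_solution \<Omega> \<nu> \<kappa> F u0 v0 T v"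
    and t: "t \<in> {0..T}"
  shows "ae_eq \<Omega> (u t) (v t)"
proof -
  let ?D = "\<lambda>f g. L2_inner \<Omega> (weak_grad \<Omega> f) (weak_grad \<Omega> g)"
  let ?J = "{0..T}"
  interpret D: semi_inner_space "H10 \<Omega>" ?D by (rule semi_inner_space_H10_Dirichlet[OF \<Omega>])
  interpret H: semi_inner_space "H10 \<Omega>" "\<lambda>f g. L2_inner \<Omega> f g + ?D f g"
    rewrites "semi_inner_space.N (\<lambda>f g. L2_inner \<Omega> f g + ?D f g) = H1_norm \<Omega>"
    by (rule semi_inner_space_H10[OF \<Omega>], rule H1_norm_eq[OF \<Omega>])
  have NL2: "semi_inner_space.N (L2_inner \<Omega>) = L2_norm \<Omega>"
    by (simp add: fun_eq_iff L2_norm_def semi_inner_space.N_def[OF semi_inner_space_L2])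
  have D_le: "D.N f \<le> H1_norm \<Omega> f" for f
    unfolding D.N_def H1_norm_def by (intro real_sqrt_le_mono) (simp add: L2_norm_def L2_inner_self_nonneg)
  from u obtain ut utt where
    u: "u \<in> C_in ?J (H10 \<Omega>) (H1_norm \<Omega>)"
    "ut \<in> C_in ?J (L2 \<Omega>) (L2_norm \<Omega>)" "utt \<in> C_in ?J (Hm1 \<Omega>) (Hm1_norm \<Omega>)"
    "has_derivative_in ?J (L2_norm \<Omega>) u ut"
    "has_derivative_in ?J (Hm1_norm \<Omega>) (\<lambda>t. L2_inner \<Omega> (ut t)) utt"
    "ae_eq \<Omega> (u 0) u0" "ae_eq \<Omega> (ut 0) v0"
    and u_eq: "\<And>\<phi> t. \<phi> \<in> C_in ?J (H10 \<Omega>) (H1_norm \<Omega>) \<Longrightarrow> t \<in> {0<..T} \<Longrightarrow>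
      utt t (\<phi> t) = - \<nu> * L2_inner \<Omega> (ut t) (\<phi> t) - \<kappa> * ?D (u t) (\<phi> t) + L2_inner \<Omega> (F (u t)) (\<phi> t)"
    unfolding weak_solution_def by blast
  from v obtain vt vtt where
    v: "v \<in> C_in ?J (H10 \<Omega>) (H1_norm \<Omega>)"
    "vt \<in> C_in ?J (L2 \<Omega>) (L2_norm \<Omega>)" "vtt \<in> C_in ?J (Hm1 \<Omega>) (Hm1_norm \<Omega>)"
    "has_derivative_in ?J (L2_norm \<Omega>) v vt"
    "has_derivative_in ?J (Hm1_norm \<Omega>) (\<lambda>t. L2_inner \<Omega> (vt t)) vtt"
    "ae_eq \<Omega> (v 0) u0" "ae_eq \<Omega> (vt 0) v0"
    and v_eq: "\<And>\<phi> t. \<phi> \<in> C_in ?J (H10 \<Omega>) (H1_norm \<Omega>) \<Longrightarrow> t \<in> {0<..T} \<Longrightarrow>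
      vtt t (\<phi> t) = - \<nu> * L2_inner \<Omega> (vt t) (\<phi> t) - \<kappa> * ?D (v t) (\<phi> t) + L2_inner \<Omega> (F (v t)) (\<phi> t)"
    unfolding weak_solution_def by blast
  have to_L2: "z \<in> C_in ?J (L2 \<Omega>) (L2_norm \<Omega>)" if "z \<in> C_in ?J (H10 \<Omega>) (H1_norm \<Omega>)" for z
    using that by (rule C_in_mono) (auto intro: H10_L2 H.diff_mem L2.N_nonneg L2_norm_le_H1_norm)
  have to_D: "z \<in> C_in ?J (H10 \<Omega>) D.N" if "z \<in> C_in ?J (H10 \<Omega>) (H1_norm \<Omega>)" for z
    using that by (rule C_in_mono) (auto intro: H.diff_mem D.N_nonneg D_le)
  note uL = to_L2[OF u(1)] and vL = to_L2[OF v(1)]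
  have memH: "u s \<in> H10 \<Omega>" "v s \<in> H10 \<Omega>" if "s \<in> ?J" for s
    using u(1) v(1) that by (auto simp: C_in_def)
  have memL: "u s \<in> L2 \<Omega>" "v s \<in> L2 \<Omega>" "ut s \<in> L2 \<Omega>" "vt s \<in> L2 \<Omega>" if "s \<in> ?J" for s
    using uL vL u(2) v(2) that by (auto simp: C_in_def)
  have memM: "utt s \<in> Hm1 \<Omega>" "vtt s \<in> Hm1 \<Omega>" if "s \<in> ?J" for s
    using u(3) v(3) that by (auto simp: C_in_def)
  obtain L where L: "0 \<le> L" "\<And>t. t \<in> ?J \<Longrightarrow>
      L2_norm \<Omega> (\<lambda>x. F (u t) x - F (v t) x) \<le> L * L2_norm \<Omega> (\<lambda>x. u t x - v t x)"
    using locally_lipschitz_along_curves[OF \<open>0 \<le> T\<close> F uL vL] by blast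
  have "semi_inner_space.N (L2_inner \<Omega>) (\<lambda>x. u t x - v t x) = 0"
  proof (rule damped_wave_zero[OF semi_inner_space_L2 D.semi_inner_space_axioms, where w = "\<lambda>t x. u t x - v t x"
        and wt = "\<lambda>t x. ut t x - vt t x" and f = "\<lambda>t x. F (u t) x - F (v t) x" and T = T and L = L], unfold NL2)
    show "H10 \<Omega> \<subseteq> L2 \<Omega>" using H10_L2 by blast
    show "(\<lambda>t x. u t x - v t x) \<in> C_in ?J (L2 \<Omega>) (L2_norm \<Omega>)"
      "(\<lambda>t x. ut t x - vt t x) \<in> C_in ?J (L2 \<Omega>) (L2_norm \<Omega>)"
      "(\<lambda>t x. F (u t) x - F (v t) x) \<in> C_in ?J (L2 \<Omega>) (L2_norm \<Omega>)"
      by (intro L2.C_in_diff C_in_continuous_operator[where F = F] F(1,2) uL vL u(2) v(2))+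
    show "(\<lambda>t x. u t x - v t x) \<in> C_in ?J (H10 \<Omega>) D.N"
      by (intro D.C_in_diff to_D u(1) v(1))
    show "has_derivative_in ?J (L2_norm \<Omega>) (\<lambda>t x. u t x - v t x) (\<lambda>t x. ut t x - vt t x)"
      using memL u(4) v(4) by (intro L2.has_derivative_in_diff) auto
    have 0: "(0::real) \<in> ?J" using \<open>0 \<le> T\<close> by simp
    show "L2_norm \<Omega> (\<lambda>x. u 0 x - v 0 x) = 0" "L2_norm \<Omega> (\<lambda>x. ut 0 x - vt 0 x) = 0"
      using u(6,7) v(6,7) memL[OF 0] by (auto simp: L2_norm_diff_eq_0_iff intro: ae_eq_trans ae_eq_sym)
    fix \<phi> s assume \<phi>: "\<phi> \<in> H10 \<Omega>" and s: "0 < s" "s < T"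
    then have sJ: "s \<in> ?J" "s \<in> {0<..T}" by auto
    \<comment> \<open>Test functions constant in time suffice, as \<open>damped_wave_zero\<close>
      tests with fixed elements.\<close>
    have c\<phi>: "(\<lambda>t. \<phi>) \<in> C_in ?J (H10 \<Omega>) (H1_norm \<Omega>)" using \<phi> by (rule H.const_in_C_in)
    have "((\<lambda>r. L2_inner \<Omega> (ut r) \<phi> - L2_inner \<Omega> (vt r) \<phi>) has_real_derivative utt s \<phi> - vtt s \<phi>) (at s within ?J)"
      by (intro derivative_intros has_real_derivative_pairing[OF \<Omega>] u(5) v(5) memL memM sJ \<phi>)
    then have "((\<lambda>r. L2_inner \<Omega> (ut r) \<phi> - L2_inner \<Omega> (vt r) \<phi>) has_real_derivative utt s \<phi> - vtt s \<phi>) (at s)"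
      using s by (simp add: at_within_Icc_at)
    \<comment> \<open>Outside the time interval nothing places \<open>ut r\<close> and
      \<open>vt r\<close> in \<open>L2\<close>, so additivity is used only on the open interval and
      the derivative is transferred there.\<close>
    moreover have "L2_inner \<Omega> (ut r) \<phi> - L2_inner \<Omega> (vt r) \<phi> = L2_inner \<Omega> (\<lambda>x. ut r x - vt r x) \<phi>"
      if "r \<in> {0<..<T}" for r
      using memL[of r] that H10_L2[OF \<phi>] by (simp add: L2.diff_left)
    ultimately have "((\<lambda>r. L2_inner \<Omega> (\<lambda>x. ut r x - vt r x) \<phi>) has_real_derivative utt s \<phi> - vtt s \<phi>) (at s)"
      using s by (elim has_field_derivative_transform_within_open[where S = "{0<..<T}"]) auto
    moreover have "utt s \<phi> - vtt s \<phi> = - \<nu> * L2_inner \<Omega> (\<lambda>x. ut s x - vt s x) \<phi>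
        - \<kappa> * ?D (\<lambda>x. u s x - v s x) \<phi> + L2_inner \<Omega> (\<lambda>x. F (u s) x - F (v s) x) \<phi>"
      using u_eq[OF c\<phi> sJ(2)] v_eq[OF c\<phi> sJ(2)] memL[OF sJ(1)] memH[OF sJ(1)] H10_L2[OF \<phi>] \<phi> F(1)
      by (simp add: L2.diff_left D.diff_left algebra_simps)
    ultimately show "((\<lambda>r. L2_inner \<Omega> (\<lambda>x. ut r x - vt r x) \<phi>) has_real_derivative
        - \<nu> * L2_inner \<Omega> (\<lambda>x. ut s x - vt s x) \<phi> - \<kappa> * ?D (\<lambda>x. u s x - v s x) \<phi>
        + L2_inner \<Omega> (\<lambda>x. F (u s) x - F (v s) x) \<phi>) (at s)"
      by simp
  qed (use L pos t in auto)
  then show ?thesis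
    using memL[OF t] by (simp add: NL2 L2_norm_diff_eq_0_iff)
qed

section \<open>Comparison of maximal solutions and their lifetimes\<close>

lemma maximal_solutions_agree:
  fixes \<Omega> :: "'a::euclidean_space set"
  assumes \<Omega>: "open \<Omega>" "bounded \<Omega>" and pos: "0 \<le> \<nu>" "0 \<le> \<kappa>"
    and F: "\<And>f. f \<in> L2 \<Omega> \<Longrightarrow> F f \<in> L2 \<Omega>" "continuous_on_L2 \<Omega> F" "locally_lipschitz_L2 \<Omega> F"
    and u1: "maximal_solution \<Omega> \<nu> \<kappa> F u0 v0 \<tau>1 u1" and u2: "maximal_solution \<Omega> \<nu> \<kappa> F u0 v0 \<tau>2 u2"
    and t: "0 \<le> t" "ereal t < \<tau>1" "ereal t < \<tau>2"
  shows "ae_eq \<Omega> (u1 t) (u2 t)"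
proof -
  \<comment> \<open>A real \<open>T\<close> strictly between these bounds gives a compact interval
    containing \<open>t\<close> on which both are weak solutions.\<close>
  have "max 0 (ereal t) < min \<tau>1 \<tau>2" "0 < min \<tau>1 \<tau>2"
    using t u1 u2 by (auto simp: maximal_solution_def)
  then obtain T where T: "max 0 (ereal t) < ereal T" "ereal T < min \<tau>1 \<tau>2"
    using ereal_dense2 by blast
  then have "0 < T" "t \<in> {0..T}" using t by auto
  moreover have "weak_solution \<Omega> \<nu> \<kappa> F u0 v0 T u1" "weak_solution \<Omega> \<nu> \<kappa> F u0 v0 T u2"
    using u1 u2 T \<open>0 < T\<close> by (auto simp: maximal_solution_def)
  ultimately show ?thesis
    using weak_solution_unique[OF \<Omega> pos _ F] by auto
qed

text \<open>A strictly shorter lifetime \<open>\<tau>1\<close> would be a finite T, and the other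
  solution, still a weak solution on the closed interval [0, T], would extend \<open>u1\<close> to
  its endpoint, against maximality.\<close>

lemma maximal_solution_not_shorter:
  fixes \<Omega> :: "'a::euclidean_space set"
  assumes \<Omega>: "open \<Omega>" "bounded \<Omega>" and pos: "0 \<le> \<nu>" "0 \<le> \<kappa>"
    and F: "\<And>f. f \<in> L2 \<Omega> \<Longrightarrow> F f \<in> L2 \<Omega>" "continuous_on_L2 \<Omega> F" "locally_lipschitz_L2 \<Omega> F"
    and u1: "maximal_solution \<Omega> \<nu> \<kappa> F u0 v0 \<tau>1 u1" and u2: "maximal_solution \<Omega> \<nu> \<kappa> F u0 v0 \<tau>2 u2"
  shows "\<not> \<tau>1 < \<tau>2"
proof
  assume less: "\<tau>1 < \<tau>2"
  have "0 < \<tau>1" using u1 by (simp add: maximal_solution_def)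
  with less obtain T where T: "\<tau>1 = ereal T" "0 < T" by (cases \<tau>1) auto
  have "weak_solution \<Omega> \<nu> \<kappa> F u0 v0 T u2"
    using u2 T less by (simp add: maximal_solution_def)
  moreover have "ae_eq \<Omega> (u2 t) (u1 t)" if "0 \<le> t" "ereal t < \<tau>1" for t
    using maximal_solutions_agree[OF \<Omega> pos F u1 u2 that] that less by (auto intro: ae_eq_sym)
  ultimately show False
    using u1 T unfolding maximal_solution_def by blast
qed

theorem proposition4p3:
  fixes \<Omega> :: "(real ^ 'n) set"
    and \<nu> \<kappa> :: real
    and u0 v0 :: "real ^ 'n \<Rightarrow> real"
    and F :: "(real ^ 'n \<Rightarrow> real) \<Rightarrow> (real ^ 'n \<Rightarrow> real)"
    and \<tau>1 \<tau>2 :: ereal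
    and u1 u2 :: "real \<Rightarrow> real ^ 'n \<Rightarrow> real"
  assumes "bounded_domain \<Omega>"
    and "convex \<Omega> \<or> domain_of_class_Ck 2 \<Omega>"
    and "\<nu> > 0" and "\<kappa> > 0"
    and "u0 \<in> H10 \<Omega>" and "v0 \<in> L2 \<Omega>"
    and "\<And>f. f \<in> L2 \<Omega> \<Longrightarrow> F f \<in> L2 \<Omega>"
    and "continuous_on_L2 \<Omega> F"
    and "bounded_on_bounded_L2 \<Omega> F"
    and "locally_lipschitz_L2 \<Omega> F"
    and "maximal_solution \<Omega> \<nu> \<kappa> F u0 v0 \<tau>1 u1"
    and "maximal_solution \<Omega> \<nu> \<kappa> F u0 v0 \<tau>2 u2"
  shows "\<tau>1 = \<tau>2 \<and> (\<forall>t. 0 \<le> t \<and> ereal t < \<tau>1 \<longrightarrow> ae_eq \<Omega> (u1 t) (u2 t))"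
proof -
  have \<Omega>: "open \<Omega>" "bounded \<Omega>" using assms(1) by (auto simp: bounded_domain_def)
  have pos: "0 \<le> \<nu>" "0 \<le> \<kappa>" using assms(3,4) by auto
  note setting = \<Omega> pos assms(7,8,10)
  have "\<not> \<tau>1 < \<tau>2" "\<not> \<tau>2 < \<tau>1"
    using maximal_solution_not_shorter[OF setting] assms(11,12) by blast+
  then have "\<tau>1 = \<tau>2" by simp
  then show ?thesis
    using maximal_solutions_agree[OF setting assms(11,12)] by blast
qed

end
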